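(* Let $n\ge5$ and write $n=2^p+m$ with integers $p\ge 0$ and $0<m\le2^p$. The first three Betti numbers of the Lie algebra $\mathfrak{m}_2(n)$ over $\mathbb{Z}_2$ are $$b_1(\mathfrak{m}_2(n))=2,\qquad b_2(\mathfrak{m}_2(n))=\lfloor\tfrac12(n+1)\rfloor,$$ $$b_3(\mathfrak{m}_2(n))=\tfrac13(2^p-1)(2^{p-1}-1)+\tfrac12m(m-1)+\lfloor\tfrac12(n-1)\rfloor.$$
   Context: $\mathfrak{m}_2(n)$ is the Lie algebra over $\mathbb{Z}_2$ with basis $e_1,\dots,e_n$ and brackets $[e_1,e_i]=e_{i+1}$ for $1<i<n$ and $[e_2,e_j]=e_{j+2}$ for $2<j<n-1$, all other brackets of basis elements (not following by antisymmetry) being zero. $b_q(\mathfrak{g})=\dim H^q(\mathfrak{g})$, where $H^q(\mathfrak{g})$ is Lie algebra cohomology with trivial coefficients $\mathbb{Z}_2$: the differential on the exterior algebra of the dual is $d\xi(X,Y)=\xi([X,Y])$ on one-forms, extended as a derivation, and $H^q(\mathfrak{g})=\ker(d:\Lambda^q\to\Lambda^{q+1})/\mathrm{Im}(d:\Lambda^{q-1}\to\Lambda^q)$. $\lfloor\cdot\rfloor$ denotes the integer part. *)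

theory Defs
  imports "HOL-Algebra.AbelCoset" "Jordan_Normal_Form.VS_Connect" "HOL-Library.Z2"
begin

section \<open>Quotient vector spaces\<close>

definition quotient_space :: "('a, 'v, 'm) module_scheme \<Rightarrow> 'v set \<Rightarrow> ('a, 'v set) module" where
  "quotient_space V W =
     \<lparr>carrier = a_rcosets\<^bsub>V\<^esub> W, mult = undefined, one = undefined,
      zero = W, add = set_add V,
      smult = (\<lambda>c X. \<Union>x\<in>X. W +>\<^bsub>V\<^esub> (c \<odot>\<^bsub>V\<^esub> x))\<rparr>"

lemma quotient_space_vectorspace:
  assumes "subspace K W V"
  shows "vectorspace K (quotient_space V W)"
proof -
  interpret S: subspace K W V by fact
  interpret V: vectorspace K V by (rule S.vs)
  interpret W: submodule K W V by (rule S.submod)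
  let ?Q = "quotient_space V W"
  have neg: "\<ominus>\<^bsub>V\<^esub> w \<in> W" if "w \<in> W" for w
  proof -
    have "(\<ominus>\<^bsub>K\<^esub> \<one>\<^bsub>K\<^esub>) \<odot>\<^bsub>V\<^esub> w \<in> W" using that by auto
    moreover have "(\<ominus>\<^bsub>K\<^esub> \<one>\<^bsub>K\<^esub>) \<odot>\<^bsub>V\<^esub> w = \<ominus>\<^bsub>V\<^esub> w"
      using that W.subset by (simp add: V.smult_l_minus subsetD)
    ultimately show ?thesis by simp
  qed
  have sub: "subgroup W (add_monoid V)"
    by (unfold_locales) (use W.subset neg in \<open>auto simp: a_inv_def\<close>)
  then interpret A: abelian_subgroup W V
    by (intro abelian_subgroupI3 additive_subgroup.intro) (auto intro: V.abelian_group_axioms)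
  have carr: "carrier ?Q = (\<lambda>v. W +>\<^bsub>V\<^esub> v) ` carrier V"
    by (auto simp: quotient_space_def A_RCOSETS_def' a_r_coset_def' )
  have add: "(W +>\<^bsub>V\<^esub> v) \<oplus>\<^bsub>?Q\<^esub> (W +>\<^bsub>V\<^esub> w) = W +>\<^bsub>V\<^esub> (v \<oplus>\<^bsub>V\<^esub> w)"
    if "v \<in> carrier V" "w \<in> carrier V" for v w
    using that A.a_rcos_sum by (simp add: quotient_space_def)
  have smult: "c \<odot>\<^bsub>?Q\<^esub> (W +>\<^bsub>V\<^esub> v) = W +>\<^bsub>V\<^esub> (c \<odot>\<^bsub>V\<^esub> v)"
    if c: "c \<in> carrier K" and v: "v \<in> carrier V" for c v
  proof -
    have "W +>\<^bsub>V\<^esub> (c \<odot>\<^bsub>V\<^esub> x) = W +>\<^bsub>V\<^esub> (c \<odot>\<^bsub>V\<^esub> v)" if x: "x \<in> W +>\<^bsub>V\<^esub> v" for x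
    proof -
      obtain w where w: "w \<in> W" "x = w \<oplus>\<^bsub>V\<^esub> v" using x by (auto simp: a_r_coset_def')
      have "c \<odot>\<^bsub>V\<^esub> x = (c \<odot>\<^bsub>V\<^esub> w) \<oplus>\<^bsub>V\<^esub> (c \<odot>\<^bsub>V\<^esub> v)"
        using w c v W.subset by (simp add: V.smult_r_distr subsetD)
      then have "c \<odot>\<^bsub>V\<^esub> x \<in> W +>\<^bsub>V\<^esub> (c \<odot>\<^bsub>V\<^esub> v)"
        using w c by (auto simp: a_r_coset_def')
      then show ?thesis
        using V.a_repr_independence[OF _ V.smult_closed[OF c v] sub] by simp
    qed
    then have "(\<Union>x\<in>W +>\<^bsub>V\<^esub> v. W +>\<^bsub>V\<^esub> (c \<odot>\<^bsub>V\<^esub> x))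
        = (\<Union>x\<in>W +>\<^bsub>V\<^esub> v. W +>\<^bsub>V\<^esub> (c \<odot>\<^bsub>V\<^esub> v))"
      by (rule SUP_cong[OF refl])
    moreover have "W +>\<^bsub>V\<^esub> v \<noteq> {}" using A.a_rcos_self v by blast
    ultimately show ?thesis by (simp add: quotient_space_def)
  qed
  have zero: "\<zero>\<^bsub>?Q\<^esub> = W +>\<^bsub>V\<^esub> \<zero>\<^bsub>V\<^esub>"
    using W.subset by (simp add: quotient_space_def)
  have ab: "abelian_group ?Q"
  proof (rule abelian_groupI)
    fix X assume "X \<in> carrier ?Q"
    then obtain v where v: "v \<in> carrier V" "X = W +>\<^bsub>V\<^esub> v" by (auto simp: carr)
    then have "(W +>\<^bsub>V\<^esub> (\<ominus>\<^bsub>V\<^esub> v)) \<oplus>\<^bsub>?Q\<^esub> X = \<zero>\<^bsub>?Q\<^esub>"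
      unfolding zero by (simp add: add V.l_neg)
    then show "\<exists>Y\<in>carrier ?Q. Y \<oplus>\<^bsub>?Q\<^esub> X = \<zero>\<^bsub>?Q\<^esub>"
      using v by (auto simp: carr)
  qed (auto simp: carr add zero V.a_ac)
  have "module K ?Q"
  proof (rule moduleI)
    show "cring K" by (rule V.R.cring_axioms)
    show "abelian_group ?Q" by (rule ab)
  qed (auto simp: carr add smult V.smult_l_distr V.smult_r_distr V.smult_assoc1)
  then show ?thesis by (simp add: vectorspace_def V.field_axioms)
qed


section \<open>The exterior algebra of the dual\<close>

text \<open>
  A vector of the \<open>n\<close>-dimensional space over \<^typ>\<open>bit\<close> is given by its coordinates
  with respect to a basis \<open>e\<^sub>1, \<dots>, e\<^sub>n\<close>; values at indices outside \<open>{1..n}\<close> are irrelevant.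

  Let \<open>x\<^sub>1, \<dots>, x\<^sub>n\<close> be the dual basis, and for \<open>I \<subseteq> {1..n}\<close> let \<open>x\<^sub>I\<close> be the product of the
  \<open>x\<^sub>i\<close> with \<open>i \<in> I\<close>.  The \<open>x\<^sub>I\<close> form a basis of the exterior algebra of the dual space, and
  an element of the exterior algebra is given by its coefficients with respect to this basis.
  In characteristic 2 there are no signs: \<open>x\<^sub>I \<and> x\<^sub>J\<close> is the monomial of \<open>I \<union> J\<close> if \<open>I\<close> and
  \<open>J\<close> are disjoint, and 0 otherwise (see \<open>wedge_monomial\<close>).
\<close>

type_synonym vector2 = "nat \<Rightarrow> bit"
type_synonym form2 = "nat set \<Rightarrow> bit"

definition basis_vector :: "nat \<Rightarrow> vector2" where
  "basis_vector i = (\<lambda>k. if k = i then 1 else 0)"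

definition monomial_form :: "nat set \<Rightarrow> form2" where
  "monomial_form I = (\<lambda>J. if J = I then 1 else 0)"

definition wedge :: "form2 \<Rightarrow> form2 \<Rightarrow> form2" where
  "wedge \<alpha> \<beta> = (\<lambda>I. \<Sum>J\<in>Pow I. \<alpha> J * \<beta> (I - J))"

definition forms :: "nat \<Rightarrow> nat \<Rightarrow> form2 set" where
  "forms n q = {\<omega>. \<forall>I. \<omega> I \<noteq> 0 \<longrightarrow> I \<subseteq> {1..n} \<and> card I = q}"

definition form_module :: "form2 set \<Rightarrow> (bit, form2) module" where
  "form_module F =
     \<lparr>carrier = F, mult = undefined, one = undefined,
      zero = (\<lambda>I. 0), add = (\<lambda>\<alpha> \<beta> I. \<alpha> I + \<beta> I), smult = (\<lambda>c \<alpha> I. c * \<alpha> I)\<rparr>"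


section \<open>Lie algebra cohomology with trivial coefficients\<close>

text \<open>
  The coefficient of \<open>d x\<^sub>k\<close> at \<open>x\<^sub>i \<and> x\<^sub>j\<close>, for \<open>i < j\<close>, is the value of \<open>d x\<^sub>k\<close> at
  \<open>(e\<^sub>i, e\<^sub>j)\<close>, which is \<open>x\<^sub>k([e\<^sub>i, e\<^sub>j])\<close>; the differential of a monomial is then given by the
  Leibniz rule.  That \<open>diff\<close> is a derivation is \<open>diff_wedge\<close>, and that it satisfies
  \<open>d\<xi>(X, Y) = \<xi>([X, Y])\<close> for every one-form \<open>\<xi>\<close> and all vectors \<open>X\<close>, \<open>Y\<close> is \<open>diff_one_form\<close>.
\<close>

definition diff_dual_basis :: "nat \<Rightarrow> (vector2 \<Rightarrow> vector2 \<Rightarrow> vector2) \<Rightarrow> nat \<Rightarrow> form2" where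
  "diff_dual_basis n br k =
     (\<lambda>I. \<Sum>i\<in>{1..n}. \<Sum>j\<in>{i<..n}.
        br (basis_vector i) (basis_vector j) k * monomial_form {i, j} I)"

definition diff_monomial :: "nat \<Rightarrow> (vector2 \<Rightarrow> vector2 \<Rightarrow> vector2) \<Rightarrow> nat set \<Rightarrow> form2" where
  "diff_monomial n br K =
     (\<lambda>I. \<Sum>k\<in>K. wedge (diff_dual_basis n br k) (monomial_form (K - {k})) I)"

definition diff :: "nat \<Rightarrow> (vector2 \<Rightarrow> vector2 \<Rightarrow> vector2) \<Rightarrow> form2 \<Rightarrow> form2" where
  "diff n br \<omega> = (\<lambda>I. \<Sum>K\<in>Pow {1..n}. \<omega> K * diff_monomial n br K I)"

definition cocycles :: "nat \<Rightarrow> (vector2 \<Rightarrow> vector2 \<Rightarrow> vector2) \<Rightarrow> nat \<Rightarrow> form2 set" where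
  "cocycles n br q = {\<omega> \<in> forms n q. diff n br \<omega> = (\<lambda>I. 0)}"

definition coboundaries :: "nat \<Rightarrow> (vector2 \<Rightarrow> vector2 \<Rightarrow> vector2) \<Rightarrow> nat \<Rightarrow> form2 set" where
  "coboundaries n br q = (if q = 0 then {\<lambda>I. 0} else diff n br ` forms n (q - 1))"

definition cohomology ::
  "nat \<Rightarrow> (vector2 \<Rightarrow> vector2 \<Rightarrow> vector2) \<Rightarrow> nat \<Rightarrow> (bit, form2 set) module" where
  "cohomology n br q = quotient_space (form_module (cocycles n br q)) (coboundaries n br q)"

definition betti :: "nat \<Rightarrow> (vector2 \<Rightarrow> vector2 \<Rightarrow> vector2) \<Rightarrow> nat \<Rightarrow> nat" where
  "betti n br q = vectorspace.dim class_ring (cohomology n br q)"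

text \<open>
  These rules rewrite addition and multiplication of \<^typ>\<open>bit\<close> into bit operations, which
  makes the ring laws inapplicable.
\<close>

declare add_bit_eq_xor [simp del] and mult_bit_eq_and [simp del]

lemma wedge_sum_left:
  "wedge (\<lambda>I. \<Sum>k\<in>A. f k I) \<beta> = (\<lambda>I. \<Sum>k\<in>A. wedge (f k) \<beta> I)"
  unfolding wedge_def by (subst sum.swap) (simp add: sum_distrib_right)

lemma wedge_sum_right:
  "wedge \<alpha> (\<lambda>I. \<Sum>k\<in>A. f k I) = (\<lambda>I. \<Sum>k\<in>A. wedge \<alpha> (f k) I)"
  unfolding wedge_def by (subst sum.swap) (simp add: sum_distrib_left)

lemma wedge_scale:
  "wedge (\<lambda>I. c * \<alpha> I) \<beta> = (\<lambda>I. c * wedge \<alpha> \<beta> I)"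
  "wedge \<alpha> (\<lambda>I. c * \<beta> I) = (\<lambda>I. c * wedge \<alpha> \<beta> I)"
  unfolding wedge_def by (simp_all add: sum_distrib_left mult.assoc mult.left_commute)

lemma wedge_commute: "wedge \<alpha> \<beta> = wedge \<beta> \<alpha>"
proof
  fix I
  show "wedge \<alpha> \<beta> I = wedge \<beta> \<alpha> I"
    unfolding wedge_def
    by (rule sum.reindex_bij_witness[where i = "\<lambda>J. I - J" and j = "\<lambda>J. I - J"])
      (auto simp: double_diff mult.commute)
qed

lemma wedge_assoc: "wedge (wedge \<alpha> \<beta>) \<gamma> = wedge \<alpha> (wedge \<beta> \<gamma>)"
proof
  fix I
  show "wedge (wedge \<alpha> \<beta>) \<gamma> I = wedge \<alpha> (wedge \<beta> \<gamma>) I"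
  proof (cases "finite I")
    case True
    have "wedge (wedge \<alpha> \<beta>) \<gamma> I
        = (\<Sum>(J, L)\<in>(SIGMA J:Pow I. Pow J). \<alpha> L * \<beta> (J - L) * \<gamma> (I - J))"
      unfolding wedge_def sum_distrib_right by (rule sum.Sigma) (auto simp: True intro: finite_subset[OF _ True])
    also have "\<dots> = (\<Sum>(L, M)\<in>(SIGMA L:Pow I. Pow (I - L)). \<alpha> L * (\<beta> M * \<gamma> (I - L - M)))"
      by (rule sum.reindex_bij_witness[where i = "\<lambda>(L, M). (L \<union> M, L)"
            and j = "\<lambda>(J, L). (L, J - L)"])
        (use True in \<open>auto simp: mult.assoc Un_Diff_cancel intro!: arg_cong2[where f = "(*)"]
          arg_cong[where f = \<beta>] arg_cong[where f = \<gamma>]\<close>)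
    also have "\<dots> = wedge \<alpha> (wedge \<beta> \<gamma>) I"
      unfolding wedge_def sum_distrib_left by (rule sum.Sigma[symmetric]) (auto simp: True)
    finally show ?thesis .
  qed (simp add: wedge_def)
qed

lemma wedge_left_commute: "wedge \<alpha> (wedge \<beta> \<gamma>) = wedge \<beta> (wedge \<alpha> \<gamma>)"
  by (metis wedge_assoc wedge_commute)

lemma wedge_monomial:
  assumes "finite I" "finite J"
  shows "wedge (monomial_form I) (monomial_form J)
    = (if I \<inter> J = {} then monomial_form (I \<union> J) else (\<lambda>_. 0))"
proof
  fix K
  have "wedge (monomial_form I) (monomial_form J) K
      = (\<Sum>L\<in>Pow K. if L = I then (if K - I = J then 1 else 0) else 0)"
    unfolding wedge_def by (rule sum.cong) (auto simp: monomial_form_def)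
  also have "\<dots> = (if I \<subseteq> K \<and> K - I = J then 1 else 0)"
  proof (cases "finite K")
    case False
    then show ?thesis using assms by (auto simp: finite_Diff2)
  qed (simp add: sum.delta)
  finally show "wedge (monomial_form I) (monomial_form J) K
      = (if I \<inter> J = {} then monomial_form (I \<union> J) else (\<lambda>_. 0)) K"
    by (auto simp: monomial_form_def)
qed

lemma form_expand:
  assumes "\<omega> \<in> forms n q"
  shows "\<omega> = (\<lambda>I. \<Sum>K\<in>Pow {1..n}. \<omega> K * monomial_form K I)"
proof
  fix I
  have "(\<Sum>K\<in>Pow {1..n}. \<omega> K * monomial_form K I) = (\<Sum>K\<in>Pow {1..n}. if K = I then \<omega> I else 0)"
    by (rule sum.cong) (auto simp: monomial_form_def)
  also have "\<dots> = (if I \<subseteq> {1..n} then \<omega> I else 0)" by simp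
  also have "\<dots> = \<omega> I" using assms by (force simp: forms_def)
  finally show "\<omega> I = (\<Sum>K\<in>Pow {1..n}. \<omega> K * monomial_form K I)" by simp
qed

lemma diff_monomial_form:
  assumes "K \<subseteq> {1..n}"
  shows "diff n br (monomial_form K) = diff_monomial n br K"
proof
  fix I
  have "diff n br (monomial_form K) I
      = (\<Sum>L\<in>Pow {1..n}. if L = K then diff_monomial n br K I else 0)"
    unfolding diff_def by (rule sum.cong) (auto simp: monomial_form_def)
  then show "diff n br (monomial_form K) I = diff_monomial n br K I"
    using assms by simp
qed

lemma diff_sum:
  "diff n br (\<lambda>I. \<Sum>k\<in>A. f k I) = (\<lambda>I. \<Sum>k\<in>A. diff n br (f k) I)"
  unfolding diff_def by (subst sum.swap) (simp add: sum_distrib_right)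

lemma diff_scale: "diff n br (\<lambda>I. c * \<alpha> I) = (\<lambda>I. c * diff n br \<alpha> I)"
  unfolding diff_def by (simp add: sum_distrib_left mult.assoc)

lemma diff_zero: "diff n br (\<lambda>I. 0) = (\<lambda>I. 0)"
  unfolding diff_def by simp

lemma diff_monomial_wedge:
  assumes I: "I \<subseteq> {1..n}" and J: "J \<subseteq> {1..n}"
  shows "diff n br (wedge (monomial_form I) (monomial_form J))
    = (\<lambda>L. wedge (diff_monomial n br I) (monomial_form J) L
         + wedge (monomial_form I) (diff_monomial n br J) L)"
proof -
  have fin: "finite I" "finite J" by (rule finite_subset[OF I], simp) (rule finite_subset[OF J], simp)
  let ?d = "diff_dual_basis n br"
  have l: "wedge (diff_monomial n br I) (monomial_form J)
      = (\<lambda>L. \<Sum>k\<in>I. wedge (?d k) (wedge (monomial_form (I - {k})) (monomial_form J)) L)"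
    unfolding diff_monomial_def wedge_sum_left wedge_assoc ..
  have r: "wedge (monomial_form I) (diff_monomial n br J)
      = (\<lambda>L. \<Sum>k\<in>J. wedge (?d k) (wedge (monomial_form I) (monomial_form (J - {k}))) L)"
    unfolding diff_monomial_def wedge_sum_right wedge_left_commute[of "monomial_form I"] ..
  have z: "wedge \<alpha> (\<lambda>_. 0) = (\<lambda>_. 0)" for \<alpha> by (simp add: wedge_def)
  show ?thesis
  proof (cases "I \<inter> J = {}")
    case True
    have "diff n br (wedge (monomial_form I) (monomial_form J)) = diff_monomial n br (I \<union> J)"
      using True fin I J by (simp add: wedge_monomial diff_monomial_form)
    also have "\<dots> = (\<lambda>L. (\<Sum>k\<in>I. wedge (?d k) (monomial_form (I \<union> J - {k})) L)
        + (\<Sum>k\<in>J. wedge (?d k) (monomial_form (I \<union> J - {k})) L))"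
      unfolding diff_monomial_def using fin True by (simp add: sum.union_disjoint)
    also have "\<dots> = (\<lambda>L. wedge (diff_monomial n br I) (monomial_form J) L
         + wedge (monomial_form I) (diff_monomial n br J) L)"
    proof -
      have "wedge (monomial_form (I - {k})) (monomial_form J) = monomial_form (I \<union> J - {k})"
        if "k \<in> I" for k
      proof -
        have "(I - {k}) \<inter> J = {}" "(I - {k}) \<union> J = I \<union> J - {k}" using True that by auto
        then show ?thesis using fin by (simp add: wedge_monomial)
      qed
      moreover have "wedge (monomial_form I) (monomial_form (J - {k})) = monomial_form (I \<union> J - {k})"
        if "k \<in> J" for k
      proof -
        have "I \<inter> (J - {k}) = {}" "I \<union> (J - {k}) = I \<union> J - {k}" using True that by auto
        then show ?thesis using fin by (simp add: wedge_monomial)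
      qed
      ultimately show ?thesis unfolding l r by simp
    qed
    finally show ?thesis .
  next
    case False
    then obtain x where x: "x \<in> I" "x \<in> J" by auto
    have "(\<lambda>L. wedge (diff_monomial n br I) (monomial_form J) L
         + wedge (monomial_form I) (diff_monomial n br J) L) = (\<lambda>L. 0)"
    proof (cases "I \<inter> J = {x}")
      case True
      have a: "wedge (monomial_form (I - {k})) (monomial_form J)
          = (if k = x then monomial_form (I \<union> J) else (\<lambda>_. 0))" for k
      proof -
        have "((I - {k}) \<inter> J = {}) = (k = x)" "k = x \<Longrightarrow> (I - {k}) \<union> J = I \<union> J" using True by auto
        then show ?thesis using fin by (simp add: wedge_monomial)
      qed
      have b: "wedge (monomial_form I) (monomial_form (J - {k}))
          = (if k = x then monomial_form (I \<union> J) else (\<lambda>_. 0))" for k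
      proof -
        have "(I \<inter> (J - {k}) = {}) = (k = x)" "k = x \<Longrightarrow> I \<union> (J - {k}) = I \<union> J" using True by auto
        then show ?thesis using fin by (simp add: wedge_monomial)
      qed
      have c: "(\<Sum>k\<in>A. wedge (?d k) (if k = x then monomial_form (I \<union> J) else (\<lambda>_. 0)) L)
          = wedge (?d x) (monomial_form (I \<union> J)) L" if "x \<in> A" "finite A" for A L
      proof -
        have "(\<Sum>k\<in>A. wedge (?d k) (if k = x then monomial_form (I \<union> J) else (\<lambda>_. 0)) L)
          = (\<Sum>k\<in>A. if k = x then wedge (?d x) (monomial_form (I \<union> J)) L else 0)"
          by (rule sum.cong) (auto simp: z)
        then show ?thesis using that by simp
      qed
      show ?thesis unfolding l r a b using x fin by (simp add: c)
    next
      case ne: False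
      have a: "wedge (monomial_form (I - {k})) (monomial_form J) = (\<lambda>_. 0)" for k
      proof -
        have "(I - {k}) \<inter> J \<noteq> {}" using ne x by blast
        then show ?thesis using fin by (simp add: wedge_monomial)
      qed
      have b: "wedge (monomial_form I) (monomial_form (J - {k})) = (\<lambda>_. 0)" for k
      proof -
        have "I \<inter> (J - {k}) \<noteq> {}" using ne x by blast
        then show ?thesis using fin by (simp add: wedge_monomial)
      qed
      show ?thesis unfolding l r a b z by simp
    qed
    then show ?thesis using False fin by (simp add: wedge_monomial diff_zero)
  qed
qed

lemma diff_wedge:
  assumes "\<alpha> \<in> forms n q" "\<beta> \<in> forms n r"
  shows "diff n br (wedge \<alpha> \<beta>) = (\<lambda>I. wedge (diff n br \<alpha>) \<beta> I + wedge \<alpha> (diff n br \<beta>) I)"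
proof -
  let ?P = "Pow {1..n}" and ?e = monomial_form and ?d = "diff_monomial n br"
  note ea = form_expand[OF assms(1)] and eb = form_expand[OF assms(2)]
  have "diff n br (wedge \<alpha> \<beta>)
      = (\<lambda>L. \<Sum>I\<in>?P. \<Sum>J\<in>?P. \<alpha> I * (\<beta> J * diff n br (wedge (?e I) (?e J)) L))"
    by (subst ea, subst eb)
      (simp only: wedge_sum_left wedge_sum_right wedge_scale diff_sum diff_scale sum_distrib_left)
  also have "\<dots> = (\<lambda>L. \<Sum>I\<in>?P. \<Sum>J\<in>?P. \<alpha> I * (\<beta> J * (wedge (?d I) (?e J) L + wedge (?e I) (?d J) L)))"
    by (intro ext sum.cong refl) (simp add: diff_monomial_wedge)
  also have "\<dots> = (\<lambda>L. (\<Sum>I\<in>?P. \<Sum>J\<in>?P. \<alpha> I * (\<beta> J * wedge (?d I) (?e J) L))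
      + (\<Sum>I\<in>?P. \<Sum>J\<in>?P. \<alpha> I * (\<beta> J * wedge (?e I) (?d J) L)))"
    by (simp add: distrib_left sum.distrib)
  also have "(\<lambda>L. \<Sum>I\<in>?P. \<Sum>J\<in>?P. \<alpha> I * (\<beta> J * wedge (?d I) (?e J) L)) = wedge (diff n br \<alpha>) \<beta>"
    unfolding arg_cong[OF eb, of "wedge (diff n br \<alpha>)"]
    by (simp only: diff_def wedge_sum_left wedge_sum_right wedge_scale sum_distrib_left)
  also have "(\<lambda>L. \<Sum>I\<in>?P. \<Sum>J\<in>?P. \<alpha> I * (\<beta> J * wedge (?e I) (?d J) L)) = wedge \<alpha> (diff n br \<beta>)"
    unfolding arg_cong[OF ea, of "\<lambda>x. wedge x (diff n br \<beta>)"]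
    by (simp only: diff_def wedge_sum_left wedge_sum_right wedge_scale sum_distrib_left)
  finally show ?thesis .
qed


section \<open>The Lie algebra \<open>\<mm>\<^sub>2(n)\<close>\<close>

definition m2_basis_bracket :: "nat \<Rightarrow> nat \<Rightarrow> nat \<Rightarrow> vector2" where
  "m2_basis_bracket n i j =
     (if i = 1 \<and> 1 < j \<and> j < n then basis_vector (j + 1)
      else if j = 1 \<and> 1 < i \<and> i < n then (\<lambda>k. - basis_vector (i + 1) k)
      else if i = 2 \<and> 2 < j \<and> j < n - 1 then basis_vector (j + 2)
      else if j = 2 \<and> 2 < i \<and> i < n - 1 then (\<lambda>k. - basis_vector (i + 2) k)
      else (\<lambda>k. 0))"

definition m2_bracket :: "nat \<Rightarrow> vector2 \<Rightarrow> vector2 \<Rightarrow> vector2" where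
  "m2_bracket n X Y = (\<lambda>k. \<Sum>i\<in>{1..n}. \<Sum>j\<in>{1..n}. X i * Y j * m2_basis_bracket n i j k)"

lemma m2_basis_bracket_alternating:
  "m2_basis_bracket n i i k = 0"
  "m2_basis_bracket n j i k = - m2_basis_bracket n i j k"
  by (auto simp: m2_basis_bracket_def)

lemma m2_bracket_basis:
  assumes "i \<in> {1..n}" "j \<in> {1..n}"
  shows "m2_bracket n (basis_vector i) (basis_vector j) = m2_basis_bracket n i j"
proof
  fix k
  have "m2_bracket n (basis_vector i) (basis_vector j) k
      = (\<Sum>a\<in>{1..n}. \<Sum>b\<in>{1..n}. if a = i then if b = j then m2_basis_bracket n i j k else 0 else 0)"
    unfolding m2_bracket_def by (intro sum.cong refl) (simp add: basis_vector_def)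
  also have "\<dots> = (\<Sum>a\<in>{1..n}. if a = i then \<Sum>b\<in>{1..n}. if b = j then m2_basis_bracket n i j k else 0 else 0)"
    by (rule sum.cong[OF refl]) simp
  also have "\<dots> = m2_basis_bracket n i j k"
    using assms by simp
  finally show "m2_bracket n (basis_vector i) (basis_vector j) k = m2_basis_bracket n i j k" .
qed

lemma sum_alternating:
  fixes g :: "nat \<Rightarrow> nat \<Rightarrow> bit"
  assumes "\<And>i. g i i = 0"
  shows "(\<Sum>i\<in>{1..n}. \<Sum>j\<in>{1..n}. g i j) = (\<Sum>i\<in>{1..n}. \<Sum>j\<in>{i<..n}. g i j + g j i)"
proof -
  have "(\<Sum>i\<in>{1..n}. \<Sum>j\<in>{1..n}. g i j)
      = (\<Sum>i\<in>{1..n}. (\<Sum>j\<in>{1..<i}. g i j) + (\<Sum>j\<in>{i<..n}. g i j))"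
  proof (rule sum.cong[OF refl])
    fix i assume "i \<in> {1..n}"
    then have "{1..n} = insert i ({1..<i} \<union> {i<..n})" by auto
    then show "(\<Sum>j\<in>{1..n}. g i j) = (\<Sum>j\<in>{1..<i}. g i j) + (\<Sum>j\<in>{i<..n}. g i j)"
      by (simp only:) (subst sum.insert, auto simp: assms intro!: sum.union_disjoint)
  qed
  also have "\<dots> = (\<Sum>i\<in>{1..n}. \<Sum>j\<in>{1..<i}. g i j) + (\<Sum>i\<in>{1..n}. \<Sum>j\<in>{i<..n}. g i j)"
    by (rule sum.distrib)
  also have "(\<Sum>i\<in>{1..n}. \<Sum>j\<in>{1..<i}. g i j) = (\<Sum>i\<in>{1..n}. \<Sum>j\<in>{i<..n}. g j i)"
    unfolding sum.Sigma[OF finite_atLeastAtMost ballI[OF finite_atLeastLessThan]]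
      sum.Sigma[OF finite_atLeastAtMost ballI[OF finite_greaterThanAtMost]]
    by (rule sum.reindex_bij_witness[where i = "\<lambda>(a, b). (b, a)" and j = "\<lambda>(a, b). (b, a)"]) auto
  finally show ?thesis by (simp add: sum.distrib add.commute)
qed

lemma diff_dual_basis_pair:
  assumes "1 \<le> a" "a < b" "b \<le> n"
  shows "diff_dual_basis n br k {a, b} = br (basis_vector a) (basis_vector b) k"
proof -
  have "diff_dual_basis n br k {a, b}
      = (\<Sum>i\<in>{1..n}. \<Sum>j\<in>{i<..n}. if i = a then if j = b then br (basis_vector a) (basis_vector b) k else 0 else 0)"
    unfolding diff_dual_basis_def
    by (intro sum.cong refl) (use assms in \<open>auto simp: monomial_form_def doubleton_eq_iff\<close>)
  also have "\<dots> = (\<Sum>i\<in>{1..n}. if i = a then \<Sum>j\<in>{a<..n}. if j = b then br (basis_vector a) (basis_vector b) k else 0 else 0)"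
    by (rule sum.cong[OF refl]) simp
  finally show ?thesis using assms by simp
qed

lemma diff_monomial_singleton: "diff_monomial n br {k} = diff_dual_basis n br k"
proof
  fix I
  have "wedge \<alpha> (monomial_form {}) I = \<alpha> I" if "finite I" for \<alpha>
  proof -
    have "wedge \<alpha> (monomial_form {}) I = (\<Sum>J\<in>Pow I. if J = I then \<alpha> I else 0)"
      unfolding wedge_def by (rule sum.cong) (auto simp: monomial_form_def)
    then show ?thesis using that by simp
  qed
  moreover have "diff_dual_basis n br k I = 0" if "infinite I"
  proof -
    have "I \<noteq> {i, j}" for i j using that by auto
    then show ?thesis by (simp add: diff_dual_basis_def monomial_form_def)
  qed
  ultimately show "diff_monomial n br {k} I = diff_dual_basis n br k I"
    by (cases "finite I") (simp_all add: diff_monomial_def, simp add: wedge_def)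
qed

lemma alternating_pair: "x * y * c + x' * y' * (- c) = c * (x * y - x' * y')" for c :: "'a :: comm_ring"
  by (simp add: algebra_simps)

lemma diff_one_form:
  assumes "\<xi> \<in> forms n 1"
  shows "(\<Sum>i\<in>{1..n}. \<Sum>j\<in>{i<..n}. diff n (m2_bracket n) \<xi> {i, j} * (X i * Y j - X j * Y i))
    = (\<Sum>k\<in>{1..n}. \<xi> {k} * m2_bracket n X Y k)"
proof -
  let ?c = "m2_basis_bracket n"
  have d: "diff n (m2_bracket n) \<xi> {i, j} = (\<Sum>k\<in>{1..n}. \<xi> {k} * ?c i j k)"
    if ij: "1 \<le> i" "i < j" "j \<le> n" for i j
  proof -
    have "diff n (m2_bracket n) \<xi> {i, j}
        = (\<Sum>K\<in>(\<lambda>k. {k}) ` {1..n}. \<xi> K * diff_monomial n (m2_bracket n) K {i, j})"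
      unfolding diff_def
    proof (rule sum.mono_neutral_right)
      show "\<forall>K\<in>Pow {1..n} - (\<lambda>k. {k}) ` {1..n}. \<xi> K * diff_monomial n (m2_bracket n) K {i, j} = 0"
      proof
        fix K assume K: "K \<in> Pow {1..n} - (\<lambda>k. {k}) ` {1..n}"
        have "card K \<noteq> 1"
          using K by (auto simp: card_1_singleton_iff)
        then have "\<xi> K = 0" using assms by (auto simp: forms_def)
        then show "\<xi> K * diff_monomial n (m2_bracket n) K {i, j} = 0" by simp
      qed
    qed auto
    also have "\<dots> = (\<Sum>k\<in>{1..n}. \<xi> {k} * ?c i j k)"
      using ij by (subst sum.reindex)
        (auto simp: diff_monomial_singleton diff_dual_basis_pair m2_bracket_basis intro!: sum.cong)
    finally show ?thesis .
  qed
  have "(\<Sum>k\<in>{1..n}. \<xi> {k} * m2_bracket n X Y k)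
      = (\<Sum>k\<in>{1..n}. \<xi> {k} * (\<Sum>i\<in>{1..n}. \<Sum>j\<in>{i<..n}. ?c i j k * (X i * Y j - X j * Y i)))"
  proof (rule sum.cong[OF refl], rule arg_cong[where f = "(*) _"])
    fix k
    have "m2_bracket n X Y k
        = (\<Sum>i\<in>{1..n}. \<Sum>j\<in>{i<..n}. X i * Y j * ?c i j k + X j * Y i * ?c j i k)"
      unfolding m2_bracket_def by (rule sum_alternating) (simp add: m2_basis_bracket_alternating)
    also have "\<dots> = (\<Sum>i\<in>{1..n}. \<Sum>j\<in>{i<..n}. ?c i j k * (X i * Y j - X j * Y i))"
      by (intro sum.cong refl) (subst m2_basis_bracket_alternating(2), rule alternating_pair)
    finally show "m2_bracket n X Y k
        = (\<Sum>i\<in>{1..n}. \<Sum>j\<in>{i<..n}. ?c i j k * (X i * Y j - X j * Y i))" .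
  qed
  also have "\<dots> = (\<Sum>i\<in>{1..n}. \<Sum>j\<in>{i<..n}. \<Sum>k\<in>{1..n}. \<xi> {k} * (?c i j k * (X i * Y j - X j * Y i)))"
    unfolding sum_distrib_left
    by (rule trans[OF sum.swap], rule sum.cong[OF refl], rule sum.swap)
  also have "\<dots> = (\<Sum>i\<in>{1..n}. \<Sum>j\<in>{i<..n}. diff n (m2_bracket n) \<xi> {i, j} * (X i * Y j - X j * Y i))"
    by (intro sum.cong refl) (simp only: d greaterThanAtMost_iff atLeastAtMost_iff sum_distrib_right mult.assoc)
  finally show ?thesis ..
qed

end

theory Submission
  imports Defs "HOL-Library.Function_Algebras"
begin

text \<open>
  Let \<open>D\<close> be the derivation of the exterior algebra of \<open>\<langle>x\<^sub>2, \<dots>, x\<^sub>n\<rangle>\<close> with \<open>x\<^sub>k \<mapsto> x\<^bsub>k-1\<^esub>\<close> and \<open>x\<^sub>2 \<mapsto> 0\<close>.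
  In characteristic 2 its powers \<open>D\<^bsup>2^s\<^esup>\<close> are derivations too, so the differential of \<open>\<mm>\<^sub>2(n)\<close> is
  \<open>x\<^sub>1 D + x\<^sub>2 D\<^sup>2\<close>, which a change of coordinates turns into \<open>x\<^sub>1 D\<close>.  Hence \<open>b\<^sub>q = k\<^sub>q + k\<^bsub>q-1\<^esub>\<close>, where
  \<open>k\<^sub>q\<close> is the dimension of the kernel of \<open>D\<close> in degree \<open>q\<close>.

  Let \<open>N = n - 1\<close> and consider \<open>k\<^sub>3\<close> as a function of \<open>N\<close>.  For \<open>N = 2\<^sup>p\<close> we have \<open>D\<^sup>N = 0\<close>, so that
  \<open>N k\<^sub>3(N)\<close> is at least the dimension \<open>N (N - 1) (N - 2) / 6\<close> of the whole space.  On the other hand,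
  an element of the kernel is determined modulo the kernel for \<open>N - 1\<close> by its coefficient of the last
  variable, and this coefficient lies in a space of dimension at most \<open>N - 2\<^sup>p\<close> if
  \<open>2\<^sup>p \<le> N < 2\<^bsup>p+1\<^esup>\<close>.  Summed up between consecutive powers of 2, these upper bounds for the
  increments agree with the lower bounds at the powers of 2, so all of them are sharp.
\<close>

section \<open>Counting in vector spaces over the field with two elements\<close>

text \<open>Coordinates in a finite basis biject the space with the functions from the basis to the
  field. Through this, Betti numbers are read off from cardinalities.\<close>

lemma (in vectorspace) card_carrier_eq_power_dim:
  assumes fin: "finite (carrier V)"
  shows "card (carrier V) = card (carrier K) ^ dim"
proof -
  have "carrier V \<subseteq> span (carrier V)" by (rule in_own_span) simp
  then have "gen_set (carrier V)"
    using span_is_subset2[of "carrier V"] by auto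
  then have "fin_dim" using fin by (auto simp: fin_dim_def)
  then obtain B where B: "finite B" "basis B" using finite_basis_exists by auto
  then have BV: "B \<subseteq> carrier V" by (simp add: basis_def)
  have "bij_betw (\<lambda>a. lincomb a B) (B \<rightarrow>\<^sub>E carrier K) (carrier V)"
  proof -
    have ex1: "\<exists>!a. a \<in> B \<rightarrow>\<^sub>E carrier K \<and> lincomb a B = v" if "v \<in> carrier V" for v
      using basis_criterion[OF B(1) BV] B(2) that by blast
    have cl: "lincomb a B \<in> carrier V" if "a \<in> B \<rightarrow>\<^sub>E carrier K" for a
      using that BV by (intro lincomb_closed) auto
    show ?thesis
      unfolding bij_betw_def inj_on_def using ex1 cl by blast
  qed
  then have "card (carrier V) = card (B \<rightarrow>\<^sub>E carrier K)" by (simp add: bij_betw_same_card)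
  then show ?thesis using B dim_basis[OF B] by (simp add: card_PiE)
qed

lemma bit_add_self [simp]: "x + x = (0::bit)"
  by (cases x) simp_all

lemma bit_add_eq_0_iff: "x + y = 0 \<longleftrightarrow> x = (y::bit)"
  by (cases x; cases y) simp_all

lemma UNIV_bit: "(UNIV :: bit set) = {0, 1}"
proof (intro equalityI subsetI)
  fix x :: bit show "x \<in> {0, 1}" by (cases x) auto
qed simp

lemma bit_functions_eq_image:
  "{f :: 'a \<Rightarrow> bit. \<forall>x. f x \<noteq> 0 \<longrightarrow> x \<in> S} = (\<lambda>A x. if x \<in> A then 1 else 0) ` Pow S"
proof (intro equalityI subsetI)
  fix f :: "'a \<Rightarrow> bit" assume f: "f \<in> {f. \<forall>x. f x \<noteq> 0 \<longrightarrow> x \<in> S}"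
  show "f \<in> (\<lambda>A x. if x \<in> A then 1 else 0) ` Pow S"
    by (rule image_eqI[of _ _ "{x. f x \<noteq> 0}"]) (use f in auto)
qed (auto split: if_splits)

lemma card_bit_functions:
  assumes "finite S"
  shows "finite {f :: 'a \<Rightarrow> bit. \<forall>x. f x \<noteq> 0 \<longrightarrow> x \<in> S}"
    and "card {f :: 'a \<Rightarrow> bit. \<forall>x. f x \<noteq> 0 \<longrightarrow> x \<in> S} = 2 ^ card S"
proof -
  have "inj_on (\<lambda>A x. if x \<in> A then 1 else (0::bit)) (Pow S)"
    by (auto simp: inj_on_def fun_eq_iff split: if_splits)
  then show "finite {f :: 'a \<Rightarrow> bit. \<forall>x. f x \<noteq> 0 \<longrightarrow> x \<in> S}"
    and "card {f :: 'a \<Rightarrow> bit. \<forall>x. f x \<noteq> 0 \<longrightarrow> x \<in> S} = 2 ^ card S"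
    unfolding bit_functions_eq_image using assms by (simp_all add: card_image card_Pow)
qed

text \<open>The scalars are 0 and 1 and each form is its own negative, so zero and sums already give
  the remaining axioms.\<close>

lemma form_module_vectorspace:
  assumes "(\<lambda>I. 0) \<in> F" and "\<And>\<alpha> \<beta>. \<alpha> \<in> F \<Longrightarrow> \<beta> \<in> F \<Longrightarrow> (\<lambda>I. \<alpha> I + \<beta> I) \<in> F"
  shows "vectorspace class_ring (form_module F)"
proof (rule vs_criteria)
  show "field (class_ring :: bit ring)" by (rule class_field.field_axioms)
  show "\<forall>v\<in>carrier (form_module F). \<exists>w\<in>carrier (form_module F).
      v \<oplus>\<^bsub>form_module F\<^esub> w = \<zero>\<^bsub>form_module F\<^esub>"
    by (auto simp: form_module_def intro!: bexI[where P = "\<lambda>w. (\<lambda>I. v I + w I) = (\<lambda>I. 0)" and x = v for v])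
  have "(\<lambda>I. c * \<alpha> I) \<in> F" if "\<alpha> \<in> F" for c \<alpha>
    using that assms(1) by (cases c) simp_all
  then show "\<forall>c v. c \<in> carrier class_ring \<and> v \<in> carrier (form_module F) \<longrightarrow>
      c \<odot>\<^bsub>form_module F\<^esub> v \<in> carrier (form_module F)"
    by (simp add: form_module_def)
qed (simp_all add: form_module_def assms algebra_simps)

text \<open>Lagrange's theorem for the additive groups.\<close>

lemma card_quotient_space:
  assumes sub: "subspace K W V" and fin: "finite (carrier V)"
  shows "card (carrier (quotient_space V W)) * card W = card (carrier V)"
proof -
  interpret S: subspace K W V by fact
  interpret V: vectorspace K V by (rule S.vs)
  interpret W: submodule K W V by (rule S.submod)
  have neg: "\<ominus>\<^bsub>V\<^esub> w \<in> W" if "w \<in> W" for w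
  proof -
    have "(\<ominus>\<^bsub>K\<^esub> \<one>\<^bsub>K\<^esub>) \<odot>\<^bsub>V\<^esub> w \<in> W" using that by auto
    moreover have "(\<ominus>\<^bsub>K\<^esub> \<one>\<^bsub>K\<^esub>) \<odot>\<^bsub>V\<^esub> w = \<ominus>\<^bsub>V\<^esub> w"
      using that W.subset by (simp add: V.smult_l_minus subsetD)
    ultimately show ?thesis by simp
  qed
  have "subgroup W (add_monoid V)"
    by (unfold_locales) (use W.subset neg in \<open>auto simp: a_inv_def\<close>)
  then have "additive_subgroup W V" by (rule additive_subgroup.intro)
  then show ?thesis
    using V.a_lagrange[OF fin] by (simp add: quotient_space_def Coset.order_def)
qed

section \<open>Counting cohomology classes\<close>

lemma finite_forms [simp]: "finite (forms n q)"
proof (rule finite_subset)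
  show "forms n q \<subseteq> {\<omega>. \<forall>I. \<omega> I \<noteq> 0 \<longrightarrow> I \<in> Pow {1..n}}" by (auto simp: forms_def)
  show "finite {\<omega> :: form2. \<forall>I. \<omega> I \<noteq> 0 \<longrightarrow> I \<in> Pow {1..n}}"
    by (rule card_bit_functions) simp
qed

lemma diff_add: "diff n br (\<lambda>I. \<alpha> I + \<beta> I) = (\<lambda>I. diff n br \<alpha> I + diff n br \<beta> I)"
  by (simp add: diff_def distrib_right sum.distrib)

lemma forms_zero: "(\<lambda>I. 0) \<in> forms n q"
  by (simp add: forms_def)

lemma forms_add: "\<alpha> \<in> forms n q \<Longrightarrow> \<beta> \<in> forms n q \<Longrightarrow> (\<lambda>I. \<alpha> I + \<beta> I) \<in> forms n q"
  unfolding forms_def mem_Collect_eq by (intro allI impI) (metis (no_types) add.right_neutral add_0)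

text \<open>The hypothesis expresses d d = 0; it is left to the concrete bracket because an
  arbitrary \<open>br\<close> may violate the Jacobi identity.\<close>

lemma two_power_betti:
  assumes sub: "coboundaries n br q \<subseteq> cocycles n br q"
  shows "2 ^ betti n br q * card (coboundaries n br q) = card (cocycles n br q)"
proof -
  let ?Z = "cocycles n br q" and ?B = "coboundaries n br q"
  have vs: "vectorspace class_ring (form_module ?Z)"
    by (rule form_module_vectorspace) (auto simp: cocycles_def forms_zero forms_add diff_zero diff_add)
  have B0: "(\<lambda>I. 0) \<in> ?B"
    unfolding coboundaries_def using forms_zero[of n "q - 1"]
    by (auto intro!: image_eqI[where x = "\<lambda>I. 0"] simp: diff_zero)
  have Badd: "(\<lambda>I. \<alpha> I + \<beta> I) \<in> ?B" if "\<alpha> \<in> ?B" "\<beta> \<in> ?B" for \<alpha> \<beta>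
    using that by (auto simp: coboundaries_def diff_add[symmetric] forms_add split: if_splits)
  have Bs: "(\<lambda>I. c * \<alpha> I) \<in> ?B" if "\<alpha> \<in> ?B" for c \<alpha>
    using that B0 by (cases c) simp_all
  have "submodule class_ring ?B (form_module ?Z)"
    using vs sub B0 Badd Bs
    by (auto simp: submodule_def vectorspace_def form_module_def)
  then have S: "subspace class_ring ?B (form_module ?Z)" using vs by (simp add: subspace_def)
  have fin: "finite ?Z" by (simp add: cocycles_def)
  have c: "card (carrier (cohomology n br q)) * card ?B = card ?Z"
    using card_quotient_space[OF S] fin by (simp add: cohomology_def form_module_def)
  interpret Q: vectorspace class_ring "cohomology n br q"
    unfolding cohomology_def by (rule quotient_space_vectorspace[OF S])
  have "(\<lambda>I. 0) \<in> ?Z" using B0 sub by auto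
  then have "card ?Z > 0" using fin by (auto simp: card_gt_0_iff)
  then have "card (carrier (cohomology n br q)) > 0" using c by (metis mult_is_0 neq0_conv)
  then have fin': "finite (carrier (cohomology n br q))" by (simp add: card_gt_0_iff)
  have "card (UNIV :: bit set) = 2" by (simp add: UNIV_bit)
  with Q.card_carrier_eq_power_dim[OF fin'] c show ?thesis
    by (simp add: betti_def)
qed

text \<open>Rank-nullity in multiplicative form: every nonempty fibre is a translate of the
  kernel.\<close>

lemma card_eq_card_image_times_card_kernel:
  fixes f :: "'a::ab_group_add \<Rightarrow> 'b::ab_group_add"
  assumes fin: "finite A"
    and diff: "\<And>x y. x \<in> A \<Longrightarrow> y \<in> A \<Longrightarrow> x - y \<in> A"
    and add: "\<And>x y. x \<in> A \<Longrightarrow> y \<in> A \<Longrightarrow> x + y \<in> A"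
    and hom: "\<And>x y. x \<in> A \<Longrightarrow> y \<in> A \<Longrightarrow> f (x + y) = f x + f y"
  shows "card A = card (f ` A) * card {x \<in> A. f x = 0}"
proof -
  have "card {x \<in> A. f x = y} = card {x \<in> A. f x = 0}" if "y \<in> f ` A" for y
  proof -
    from that obtain a where a: "a \<in> A" "y = f a" by auto
    have m: "f (x - a) = f x - y" if "x \<in> A" for x
      using hom[OF diff[OF that a(1)] a(1)] a(2) by (simp add: eq_diff_eq)
    show ?thesis
      by (rule bij_betw_same_card[OF bij_betw_byWitness[where f = "\<lambda>x. x - a" and f' = "\<lambda>x. x + a"]])
        (use a in \<open>auto simp: m diff add hom\<close>)
  qed
  then have "(\<Sum>y\<in>f ` A. card {x \<in> A. f x = y}) = card (f ` A) * card {x \<in> A. f x = 0}"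
    by simp
  moreover have "(\<Sum>y\<in>f ` A. card {x \<in> A. f x = y}) = card A"
    using sum.image_gen[OF fin, of "\<lambda>_. 1::nat" f] by simp
  ultimately show ?thesis by simp
qed

text \<open>In characteristic 2 the two members of an orbit {x, h x} cancel, and fixed points
  contribute nothing.\<close>

lemma sum_involution_eq_0:
  fixes g :: "'a \<Rightarrow> bit"
  assumes "finite A"
    and "\<And>x. x \<in> A \<Longrightarrow> h x \<in> A" "\<And>x. x \<in> A \<Longrightarrow> h (h x) = x"
    and "\<And>x. x \<in> A \<Longrightarrow> g (h x) = g x" "\<And>x. x \<in> A \<Longrightarrow> h x = x \<Longrightarrow> g x = 0"
  shows "sum g A = 0"
  using assms
proof (induction A rule: finite_psubset_induct)
  case (psubset A)
  show ?case
  proof (cases "A = {}")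
    case False
    then obtain x where x: "x \<in> A" by auto
    let ?B = "A - {x, h x}"
    have "sum g ?B = 0"
    proof (rule psubset.IH)
      fix y assume y: "y \<in> ?B"
      then show "h y \<in> ?B" using psubset.prems(1,2) x by (metis DiffD1 DiffD2 DiffI insert_iff singletonD)
    qed (use x psubset.prems in auto)
    moreover have "sum g A = sum g {x, h x} + sum g ?B"
      using x psubset.prems(1) psubset.hyps by (subst sum.subset_diff[of "{x, h x}" A]) (auto simp: add.commute)
    moreover have "sum g {x, h x} = 0"
      using psubset.prems(3,4)[OF x] by (cases "h x = x") simp_all
    ultimately show ?thesis by simp
  qed simp
qed

section \<open>The operator \<open>D = ad\<^sup>* e\<^sub>1\<close> and its powers\<close>

text \<open>
  On monomials, \<open>shift r\<close> is the derivation of the exterior algebra of \<open>\<langle>x\<^sub>2, x\<^sub>3, \<dots>\<rangle>\<close> with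
  \<open>x\<^sub>k \<mapsto> x\<^bsub>k-r\<^esub>\<close>, where \<open>x\<^sub>j = 0\<close> for \<open>j < 2\<close>.
\<close>

definition shift :: "nat \<Rightarrow> form2 \<Rightarrow> form2" where
  "shift r \<omega> = (\<lambda>I. if finite I \<and> I \<subseteq> {2..}
     then \<Sum>i\<in>{i \<in> I. i + r \<notin> I}. \<omega> (insert (i + r) (I - {i})) else 0)"

definition tail_forms :: "nat \<Rightarrow> nat \<Rightarrow> form2 set" where
  "tail_forms n q = {\<omega>. \<forall>I. \<omega> I \<noteq> 0 \<longrightarrow> I \<subseteq> {2..n} \<and> card I = q}"

text \<open>Exterior multiplication by x_k, read off on coefficients.\<close>

definition mul_var :: "nat \<Rightarrow> form2 \<Rightarrow> form2" where
  "mul_var k \<omega> = (\<lambda>I. if k \<in> I then \<omega> (I - {k}) else 0)"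

lemma shift_add: "shift r (\<alpha> + \<beta>) = shift r \<alpha> + shift r \<beta>"
  by (auto simp: shift_def fun_eq_iff sum.distrib)

lemma shift_zero [simp]: "shift r 0 = 0"
  by (auto simp: shift_def fun_eq_iff)

lemma mul_var_add: "mul_var k (\<alpha> + \<beta>) = mul_var k \<alpha> + mul_var k \<beta>"
  by (auto simp: mul_var_def fun_eq_iff)

lemma mul_var_mul_var_self [simp]: "mul_var k (mul_var k \<alpha>) = 0"
  by (auto simp: mul_var_def fun_eq_iff)

lemma mul_var_zero [simp]: "mul_var k 0 = 0"
  by (simp add: mul_var_def fun_eq_iff)

lemma form_add_self [simp]: "\<alpha> + \<alpha> = (0 :: 'a \<Rightarrow> bit)"
  by (simp add: fun_eq_iff)

lemma form_diff_eq_add [simp]: "\<alpha> - \<beta> = (\<alpha> + \<beta> :: 'a \<Rightarrow> bit)"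
  by (simp add: fun_eq_iff)

lemma forms_plus: "\<alpha> \<in> forms n q \<Longrightarrow> \<beta> \<in> forms n q \<Longrightarrow> \<alpha> + \<beta> \<in> forms n q"
  unfolding plus_fun_def by (rule forms_add)

lemma tail_forms_zero [simp]: "0 \<in> tail_forms n q"
  by (simp add: tail_forms_def)

lemma tail_forms_add: "\<alpha> \<in> tail_forms n q \<Longrightarrow> \<beta> \<in> tail_forms n q \<Longrightarrow> \<alpha> + \<beta> \<in> tail_forms n q"
  unfolding tail_forms_def mem_Collect_eq plus_fun_apply
  by (intro allI impI) (metis (no_types) add.right_neutral add_0)

lemma shift_tail_forms:
  assumes "\<omega> \<in> tail_forms n q"
  shows "shift r \<omega> \<in> tail_forms n q"
  unfolding tail_forms_def
proof (intro CollectI allI impI)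
  fix I assume "shift r \<omega> I \<noteq> 0"
  then have I: "finite I" "I \<subseteq> {2..}" and
    ne: "(\<Sum>i\<in>{i \<in> I. i + r \<notin> I}. \<omega> (insert (i + r) (I - {i}))) \<noteq> 0"
    by (auto simp: shift_def split: if_splits)
  obtain i where i: "i \<in> I" "i + r \<notin> I" "\<omega> (insert (i + r) (I - {i})) \<noteq> 0"
    using sum.not_neutral_contains_not_neutral[OF ne] by blast
  from i(3) assms have *: "insert (i + r) (I - {i}) \<subseteq> {2..n}" "card (insert (i + r) (I - {i})) = q"
    unfolding tail_forms_def by blast+
  have "card (insert (i + r) (I - {i})) = Suc (card (I - {i}))" using I i by simp
  with *(2) card.remove[OF I(1) i(1)] have "card I = q" by simp
  moreover have "I - {i} \<subseteq> {2..n}" "i \<in> {2..n}" using *(1) I(2) i(1) by auto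
  then have "I \<subseteq> {2..n}" by blast
  ultimately show "I \<subseteq> {2..n} \<and> card I = q" by simp
qed

lemma mul_var_tail_forms:
  assumes "\<omega> \<in> tail_forms n q" "2 \<le> n"
  shows "mul_var 2 \<omega> \<in> tail_forms n (Suc q)"
  unfolding tail_forms_def
proof (intro CollectI allI impI)
  fix I assume "mul_var 2 \<omega> I \<noteq> 0"
  then have I: "2 \<in> I" "\<omega> (I - {2}) \<noteq> 0" by (auto simp: mul_var_def split: if_splits)
  then have *: "I - {2} \<subseteq> {2..n}" "card (I - {2}) = q"
    using assms(1) unfolding tail_forms_def by blast+
  from finite_subset[OF *(1)] have "finite I" by simp
  from card.remove[OF this I(1)] *(2) have "card I = Suc q" by simp
  moreover have "I \<subseteq> {2..n}" using *(1) assms(2) by auto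
  ultimately show "I \<subseteq> {2..n} \<and> card I = Suc q" by simp
qed

text \<open>The derivation kills x_2, so by the Leibniz rule it commutes with multiplication by
  x_2.\<close>

lemma shift_mul_var:
  assumes "r > 0"
  shows "shift r (mul_var 2 \<omega>) = mul_var 2 (shift r \<omega>)"
proof
  fix I
  show "shift r (mul_var 2 \<omega>) I = mul_var 2 (shift r \<omega>) I"
  proof (cases "finite I \<and> I \<subseteq> {2..}")
    case True
    have n: "i + r \<noteq> 2" if "i \<in> I" for i
    proof -
      have "i \<ge> 2" using that True by auto
      then show ?thesis using assms by simp
    qed
    show ?thesis
    proof (cases "2 \<in> I")
      case False
      then have "mul_var 2 \<omega> (insert (i + r) (I - {i})) = 0" if "i \<in> I" for i
        using n[OF that] by (simp add: mul_var_def)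
      then show ?thesis using False by (simp add: shift_def mul_var_def)
    next
      case 2: True
      have "shift r (mul_var 2 \<omega>) I
          = (\<Sum>i\<in>{i \<in> I. i + r \<notin> I}. mul_var 2 \<omega> (insert (i + r) (I - {i})))"
        using True by (simp add: shift_def)
      \<comment> \<open>The term i = 2 drops out: replacing 2 by 2 + r removes the factor
        x_2.\<close>
      also have "\<dots> = (\<Sum>i\<in>{i \<in> I - {2}. i + r \<notin> I - {2}}. \<omega> (insert (i + r) (I - {2} - {i})))"
      proof (rule sum.mono_neutral_cong_right)
        show "\<forall>i\<in>{i \<in> I. i + r \<notin> I} - {i \<in> I - {2}. i + r \<notin> I - {2}}.
            mul_var 2 \<omega> (insert (i + r) (I - {i})) = 0"
          using n by (auto simp: mul_var_def)
        fix i assume i: "i \<in> {i \<in> I - {2}. i + r \<notin> I - {2}}"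
        then have "insert (i + r) (I - {i}) - {2} = insert (i + r) (I - {2} - {i})"
          using n[of i] by auto
        then show "mul_var 2 \<omega> (insert (i + r) (I - {i})) = \<omega> (insert (i + r) (I - {2} - {i}))"
          using 2 i by (simp add: mul_var_def)
      qed (use True n in auto)
      also have "\<dots> = mul_var 2 (shift r \<omega>) I"
        using True 2 by (auto simp: mul_var_def shift_def)
      finally show ?thesis .
    qed
  next
    case False
    then have "\<not> (finite (I - {2}) \<and> I - {2} \<subseteq> {2..})" by auto
    then show ?thesis using False by (auto simp: shift_def mul_var_def)
  qed
qed

text \<open>In characteristic 2 the square of a derivation is a derivation.\<close>

lemma shift_shift:
  assumes r: "r > 0"
  shows "shift r (shift r \<omega>) = shift (2 * r) \<omega>"
proof
  fix I
  show "shift r (shift r \<omega>) I = shift (2 * r) \<omega> I"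
  proof (cases "finite I \<and> I \<subseteq> {2..}")
    case True
    then have fin: "finite I" by simp
    define M where "M i = insert (i + r) (I - {i})" for i
    define A where "A J = {j \<in> J. j + r \<notin> J}" for J
    define g where "g = (\<lambda>(i, j). \<omega> (insert (j + r) (M i - {j})))"
    let ?S = "SIGMA i:A I. A (M i)"
    \<comment> \<open>The pairs whose two raisings interact: the same index is raised twice, or i =
      j + r is raised first and j then fills the gap.\<close>
    let ?P = "{(i, j) \<in> ?S. j = i + r \<or> i = j + r}"
    have finS: "finite ?S" using fin by (auto simp: A_def M_def)
    have "shift r (shift r \<omega>) I = (\<Sum>i\<in>A I. shift r \<omega> (M i))"
      using True by (simp add: shift_def[of r "shift r \<omega>"] A_def M_def)
    also have "\<dots> = (\<Sum>i\<in>A I. \<Sum>j\<in>A (M i). g (i, j))"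
    proof (rule sum.cong[OF refl])
      fix i assume "i \<in> A I"
      then have "finite (M i) \<and> M i \<subseteq> {2..}" using True by (auto simp: M_def A_def subset_iff)
      then show "shift r \<omega> (M i) = (\<Sum>j\<in>A (M i). g (i, j))" by (simp add: shift_def A_def g_def)
    qed
    also have "\<dots> = sum g ?S"
      using fin by (simp add: sum.Sigma A_def M_def)
    also have "\<dots> = sum g (?S - ?P) + sum g ?P"
      by (rule sum.subset_diff) (use finS in auto)
    \<comment> \<open>All other raisings commute, so (i, j) and (j, i) cancel.\<close>
    also have "sum g (?S - ?P) = 0"
    proof (rule sum_involution_eq_0[where h = "\<lambda>(i, j). (j, i)"])
      fix x assume x: "x \<in> ?S - ?P"
      show "(case x of (i, j) \<Rightarrow> (j, i)) \<in> ?S - ?P"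
        using x by (auto simp: A_def M_def)
      obtain i j where ij: "x = (i, j)" by (cases x)
      have "j \<noteq> i + r" "i \<noteq> j + r" using x by (auto simp: ij)
      then have "insert (j + r) (insert (i + r) (I - {i}) - {j}) = insert (i + r) (insert (j + r) (I - {j}) - {i})"
        by blast
      then show "g (case x of (i, j) \<Rightarrow> (j, i)) = g x" by (simp add: ij g_def M_def)
      show "g x = 0" if "(case x of (i, j) \<Rightarrow> (j, i)) = x"
      proof -
        have "j = i" using that unfolding ij prod.case by (rule Pair_inject)
        moreover have "j \<in> M i" using x unfolding ij A_def by blast
        ultimately show ?thesis using r by (simp add: M_def)
      qed
    qed (use finS in auto)
    \<comment> \<open>Each i with i + 2r outside I comes from exactly one interacting pair; which
      one depends on whether i + r lies in I.\<close>
    also have "sum g ?P = (\<Sum>i\<in>{i \<in> I. i + 2 * r \<notin> I}. \<omega> (insert (i + 2 * r) (I - {i})))"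
    proof (rule sum.reindex_bij_witness[where
            i = "\<lambda>i. if i + r \<in> I then (i + r, i) else (i, i + r)" and
            j = "\<lambda>(i, j). if j = i + r then i else j"])
      fix x assume x: "x \<in> ?P"
      obtain i j where ij: "x = (i, j)" by (cases x)
      from x have i: "i \<in> I" "i + r \<notin> I" and j: "j \<in> M i" "j = i + r \<or> i = j + r"
        by (auto simp: ij A_def)
      from j(2) show "\<omega> (insert ((case x of (i, j) \<Rightarrow> if j = i + r then i else j) + 2 * r)
            (I - {case x of (i, j) \<Rightarrow> if j = i + r then i else j})) = g x"
      proof
        assume ji: "j = i + r"
        have "insert (i + r + r) (insert (i + r) (I - {i}) - {i + r}) = insert (i + 2 * r) (I - {i})"
          using i by auto
        then show ?thesis by (simp add: ij g_def M_def ji)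
      next
        assume ji: "i = j + r"
        have "j \<in> I" using j(1) r by (simp add: M_def ji)
        then have "insert (j + r) (insert (j + r + r) (I - {j + r}) - {j}) = insert (j + 2 * r) (I - {j})"
          using i r by (auto simp: ji)
        then show ?thesis using r by (simp add: ij g_def M_def ji)
      qed
    qed (use r in \<open>auto simp: A_def M_def mult_2 add.assoc\<close>)
    finally show ?thesis using True by (simp add: shift_def)
  qed (auto simp: shift_def)
qed

section \<open>The cohomology of \<open>\<mm>\<^sub>2(n)\<close> in terms of the kernel of \<open>D\<close>\<close>

text \<open>Among the brackets with i < j, e_k arises only as [e_1, e_(k-1)] with k - 1 > 1 and as
  [e_2, e_(k-2)] with k - 2 > 2; hence the thresholds 3 and 5.\<close>

lemma diff_dual_basis_m2:
  assumes "k \<in> {1..n}"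
  shows "diff_dual_basis n (m2_bracket n) k =
    (\<lambda>I. (if 3 \<le> k then monomial_form {1, k - 1} I else 0)
       + (if 5 \<le> k then monomial_form {2, k - 2} I else 0))"
proof
  fix I
  let ?f = "\<lambda>r. monomial_form {r, k - r} I"
  have "diff_dual_basis n (m2_bracket n) k I = (\<Sum>i\<in>{1..n}. \<Sum>j\<in>{i<..n}.
        (if i = 1 then if j = k - 1 then ?f 1 else 0 else 0)
      + (if i = 2 then if j = k - 2 then ?f 2 else 0 else 0))"
    unfolding diff_dual_basis_def
  proof (intro sum.cong refl)
    fix i j assume ij: "i \<in> {1..n}" "j \<in> {i<..n}"
    then have "m2_bracket n (basis_vector i) (basis_vector j) = m2_basis_bracket n i j"
      by (intro m2_bracket_basis) auto
    moreover have "m2_basis_bracket n i j k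
        = (if i = 1 \<and> j = k - 1 then 1 else 0) + (if i = 2 \<and> j = k - 2 then 1 else 0)"
    proof -
      have "j \<le> n" "k \<le> n" "1 \<le> i" "i < j" using ij assms by auto
      then consider "i = 1" "1 < j" | "i = 2" "2 < j" | "2 < i" by linarith
      then show ?thesis
      proof cases
        case 1
        then show ?thesis using \<open>j \<le> n\<close> \<open>k \<le> n\<close>
          by (auto simp: m2_basis_bracket_def basis_vector_def)
      next
        case 2
        then have "j = k - 2 \<longleftrightarrow> j < n - 1 \<and> k = j + 2" using \<open>j \<le> n\<close> \<open>k \<le> n\<close> by linarith
        then show ?thesis using 2 by (simp add: m2_basis_bracket_def basis_vector_def)
      next
        case 3
        then show ?thesis using \<open>i < j\<close> by (simp add: m2_basis_bracket_def)
      qed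
    qed
    ultimately show "m2_bracket n (basis_vector i) (basis_vector j) k * monomial_form {i, j} I =
        (if i = 1 then if j = k - 1 then ?f 1 else 0 else 0)
      + (if i = 2 then if j = k - 2 then ?f 2 else 0 else 0)"
      by (simp add: distrib_right)
  qed
  also have "\<dots> = (\<Sum>i\<in>{1..n}. (if i = 1 then \<Sum>j\<in>{1<..n}. if j = k - 1 then ?f 1 else 0 else 0)
      + (if i = 2 then \<Sum>j\<in>{2<..n}. if j = k - 2 then ?f 2 else 0 else 0))"
    by (rule sum.cong) (auto simp: sum.distrib)
  also have "\<dots> = (if 3 \<le> k then ?f 1 else 0) + (if 5 \<le> k then ?f 2 else 0)"
    using assms by (auto simp: sum.distrib)
  finally show "diff_dual_basis n (m2_bracket n) k I = (if 3 \<le> k then ?f 1 else 0) + (if 5 \<le> k then ?f 2 else 0)" .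
qed

text \<open>With r in {1, 2} both thresholds become 2r < k, which also keeps r, k - r and k
  distinct. A product survives only if it repeats no variable.\<close>

lemma diff_monomial_m2:
  assumes "K \<subseteq> {1..n}"
  shows "diff_monomial n (m2_bracket n) K I = (\<Sum>r\<in>{1, 2}. \<Sum>k\<in>K.
    if 2 * r < k \<and> r \<notin> K \<and> k - r \<notin> K \<and> I = insert r (insert (k - r) (K - {k})) then 1 else 0)"
proof -
  let ?t = "\<lambda>r k. if 2 * r < k \<and> r \<notin> K \<and> k - r \<notin> K \<and> I = insert r (insert (k - r) (K - {k})) then 1 else 0 :: bit"
  have fin: "finite K" using assms by (rule finite_subset) simp
  have "wedge (diff_dual_basis n (m2_bracket n) k) (monomial_form (K - {k})) I = ?t 1 k + ?t 2 k"
    if "k \<in> K" for k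
  proof -
    have w: "wedge (monomial_form {r, k - r}) (monomial_form (K - {k})) I = ?t r k"
      if r: "0 < r" "2 * r < k" for r
    proof -
      have inter: "{r, k - r} \<inter> (K - {k}) = {} \<longleftrightarrow> r \<notin> K \<and> k - r \<notin> K" using r by auto
      have "finite {r, k - r}" "finite (K - {k})" using fin by simp_all
      from wedge_monomial[OF this] show ?thesis unfolding inter using r by (simp add: monomial_form_def)
    qed
    have "wedge (diff_dual_basis n (m2_bracket n) k) (monomial_form (K - {k})) I
      = (if 3 \<le> k then wedge (monomial_form {1, k - 1}) (monomial_form (K - {k})) I else 0)
      + (if 5 \<le> k then wedge (monomial_form {2, k - 2}) (monomial_form (K - {k})) I else 0)"
      using assms that by (subst diff_dual_basis_m2) (auto simp: wedge_def distrib_right sum.distrib)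
    also have "(if 3 \<le> k then wedge (monomial_form {1, k - 1}) (monomial_form (K - {k})) I else 0) = ?t 1 k"
    proof (cases "3 \<le> k")
      case True
      then show ?thesis using w[of 1] by (simp only: if_True) simp
    qed simp
    also have "(if 5 \<le> k then wedge (monomial_form {2, k - 2}) (monomial_form (K - {k})) I else 0) = ?t 2 k"
    proof (cases "5 \<le> k")
      case True
      then show ?thesis using w[of 2] by (simp only: if_True) simp
    qed simp
    finally show ?thesis .
  qed
  then show ?thesis unfolding diff_monomial_def by (simp add: sum.distrib)
qed

text \<open>The transpose of \<open>diff_monomial_m2\<close>: the coefficient at I collects the
  monomials K that lead to I, indexed by i = k - r, so that 2r < k reads r < i.\<close>

lemma diff_m2:
  assumes \<omega>: "\<omega> \<in> forms n q"
  shows "diff n (m2_bracket n) \<omega> I = (\<Sum>r\<in>{1, 2}. if r \<in> I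
    then \<Sum>i\<in>{i \<in> I. r < i \<and> i + r \<notin> I}. \<omega> (insert (i + r) (I - {r, i})) else 0)"
proof -
  let ?c = "\<lambda>r K k. 2 * r < k \<and> r \<notin> K \<and> k - r \<notin> K \<and> I = insert r (insert (k - r) (K - {k}))"
  have "diff n (m2_bracket n) \<omega> I
      = (\<Sum>K\<in>Pow {1..n}. \<Sum>r\<in>{1, 2}. \<Sum>k\<in>K. if ?c r K k then \<omega> K else 0)"
    unfolding diff_def
  proof (rule sum.cong[OF refl])
    fix K assume "K \<in> Pow {1..n}"
    then have "\<omega> K * diff_monomial n (m2_bracket n) K I
        = (\<Sum>r\<in>{1, 2}. \<Sum>k\<in>K. \<omega> K * (if ?c r K k then 1 else 0))"
      by (simp only: diff_monomial_m2 sum_distrib_left Pow_iff)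
    also have "\<dots> = (\<Sum>r\<in>{1, 2}. \<Sum>k\<in>K. if ?c r K k then \<omega> K else 0)"
      by (intro sum.cong refl) simp
    finally show "\<omega> K * diff_monomial n (m2_bracket n) K I
        = (\<Sum>r\<in>{1, 2}. \<Sum>k\<in>K. if ?c r K k then \<omega> K else 0)" .
  qed
  also have "\<dots> = (\<Sum>r\<in>{1, 2}. \<Sum>K\<in>Pow {1..n}. \<Sum>k\<in>K. if ?c r K k then \<omega> K else 0)"
    by (rule sum.swap)
  also have "\<dots> = (\<Sum>r\<in>{1, 2}. if r \<in> I
    then \<Sum>i\<in>{i \<in> I. r < i \<and> i + r \<notin> I}. \<omega> (insert (i + r) (I - {r, i})) else 0)"
  proof (rule sum.cong[OF refl])
    fix r :: nat assume "r \<in> {1, 2}"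
    then have r: "r > 0" by auto
    let ?S = "SIGMA K:Pow {1..n}. {k \<in> K. ?c r K k}"
    have "(\<Sum>K\<in>Pow {1..n}. \<Sum>k\<in>K. if ?c r K k then \<omega> K else 0)
        = (\<Sum>K\<in>Pow {1..n}. \<Sum>k\<in>{k \<in> K. ?c r K k}. \<omega> K)"
      by (rule sum.cong[OF refl], rule sum.inter_filter[symmetric]) (auto intro: finite_subset)
    also have "\<dots> = (\<Sum>(K, k)\<in>?S. \<omega> K)"
      by (rule sum.Sigma) (auto intro: finite_subset)
    finally have L: "(\<Sum>K\<in>Pow {1..n}. \<Sum>k\<in>K. if ?c r K k then \<omega> K else 0) = (\<Sum>(K, k)\<in>?S. \<omega> K)" .
    show "(\<Sum>K\<in>Pow {1..n}. \<Sum>k\<in>K. if ?c r K k then \<omega> K else 0) = (if r \<in> I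
      then \<Sum>i\<in>{i \<in> I. r < i \<and> i + r \<notin> I}. \<omega> (insert (i + r) (I - {r, i})) else 0)"
    proof (cases "r \<in> I \<and> finite I")
      case False
      moreover have "\<omega> (insert (i + r) (I - {r, i})) = 0" if "infinite I" for i
      proof -
        have "\<not> insert (i + r) (I - {r, i}) \<subseteq> {1..n}"
          using that by (meson finite_Diff2 finite.emptyI finite.insertI finite_atLeastAtMost finite_insert finite_subset)
        then show ?thesis using \<omega> unfolding forms_def by blast
      qed
      moreover have "?S = {}" using False by (auto intro: finite_subset)
      ultimately show ?thesis unfolding L by auto
    next
      case True
      \<comment> \<open>The reindexing requires K inside {1..n}; elsewhere \<open>\<omega>\<close>
        vanishes, so the restriction is lifted afterwards.\<close>
      let ?T = "{i \<in> I. r < i \<and> i + r \<notin> I \<and> insert (i + r) (I - {r, i}) \<subseteq> {1..n}}"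
      have "(\<Sum>(K, k)\<in>?S. \<omega> K) = (\<Sum>i\<in>?T. \<omega> (insert (i + r) (I - {r, i})))"
      proof (rule sum.reindex_bij_witness[where i = "\<lambda>i. (insert (i + r) (I - {r, i}), i + r)"
              and j = "\<lambda>(K, k). k - r"])
        fix x assume x: "x \<in> ?S"
        obtain K k where Kk: "x = (K, k)" by (cases x)
        have "insert (k - r + r) (I - {r, k - r}) = K" using x r by (auto simp: Kk)
        moreover from this show "(insert ((case x of (K, k) \<Rightarrow> k - r) + r) (I - {r, case x of (K, k) \<Rightarrow> k - r}),
            (case x of (K, k) \<Rightarrow> k - r) + r) = x"
          using x by (auto simp: Kk)
        ultimately show "\<omega> (insert ((case x of (K, k) \<Rightarrow> k - r) + r) (I - {r, case x of (K, k) \<Rightarrow> k - r}))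
            = (case x of (K, k) \<Rightarrow> \<omega> K)" "(case x of (K, k) \<Rightarrow> k - r) \<in> ?T"
          using x r by (auto simp: Kk)
      next
        fix i assume i: "i \<in> ?T"
        have "I = insert r (insert i (insert (i + r) (I - {r, i}) - {i + r}))"
          using i True by auto
        then show "(insert (i + r) (I - {r, i}), i + r) \<in> ?S"
          using i r by auto
      qed auto
      also have "\<dots> = (\<Sum>i\<in>{i \<in> I. r < i \<and> i + r \<notin> I}. \<omega> (insert (i + r) (I - {r, i})))"
      proof (rule sum.mono_neutral_left)
        have "J \<subseteq> {1..n}" if "\<omega> J \<noteq> 0" for J using \<omega> that unfolding forms_def by blast
        then show "\<forall>i\<in>{i \<in> I. r < i \<and> i + r \<notin> I} - ?T. \<omega> (insert (i + r) (I - {r, i})) = 0"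
          by blast
      qed (use True in auto)
      finally show ?thesis using L True by simp
    qed
  qed
  finally show ?thesis .
qed


section \<open>Splitting off x_1\<close>

text \<open>Every form is x_1 a + b with a and b free of x_1; this is a, and
  \<open>x1_free_part\<close> is b.\<close>

definition x1_factor :: "form2 \<Rightarrow> form2" where
  "x1_factor \<omega> = (\<lambda>I. if 1 \<in> I then 0 else \<omega> (insert 1 I))"

definition x1_free_part :: "form2 \<Rightarrow> form2" where
  "x1_free_part \<omega> = (\<lambda>I. if 1 \<in> I then 0 else \<omega> I)"

lemma x1_split: "\<omega> = mul_var 1 (x1_factor \<omega>) + x1_free_part \<omega>"
  by (auto simp: fun_eq_iff mul_var_def x1_factor_def x1_free_part_def insert_absorb)

lemma x1_factor_mem:
  assumes "\<omega> \<in> forms n (Suc q)"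
  shows "x1_factor \<omega> \<in> tail_forms n q"
  unfolding tail_forms_def
proof (intro CollectI allI impI)
  fix I assume "x1_factor \<omega> I \<noteq> 0"
  then have I: "1 \<notin> I" "\<omega> (insert 1 I) \<noteq> 0" by (auto simp: x1_factor_def split: if_splits)
  then have *: "insert 1 I \<subseteq> {1..n}" "card (insert 1 I) = Suc q"
    using assms unfolding forms_def by blast+
  from finite_subset[OF *(1)] have "finite I" by simp
  with * I(1) have "card I = q" by simp
  moreover have "k \<in> {2..n}" if "k \<in> I" for k
  proof -
    have "k \<noteq> 1" "k \<in> {1..n}" using that * I(1) by auto
    then show ?thesis by simp
  qed
  ultimately show "I \<subseteq> {2..n} \<and> card I = q" by blast
qed

lemma x1_free_part_mem:
  assumes "\<omega> \<in> forms n q"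
  shows "x1_free_part \<omega> \<in> tail_forms n q"
  unfolding tail_forms_def
proof (intro CollectI allI impI)
  fix I assume "x1_free_part \<omega> I \<noteq> 0"
  then have I: "1 \<notin> I" "\<omega> I \<noteq> 0" by (auto simp: x1_free_part_def split: if_splits)
  then have *: "I \<subseteq> {1..n}" "card I = q"
    using assms unfolding forms_def by blast+
  moreover have "k \<in> {2..n}" if "k \<in> I" for k
  proof -
    have "k \<noteq> 1" "k \<in> {1..n}" using that * I(1) by auto
    then show ?thesis by simp
  qed
  ultimately show "I \<subseteq> {2..n} \<and> card I = q" by blast
qed

lemma x1_factor_0: "\<omega> \<in> forms n 0 \<Longrightarrow> x1_factor \<omega> = 0"
proof
  fix I assume \<omega>: "\<omega> \<in> forms n 0"
  have "\<omega> (insert 1 I) = 0"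
  proof (rule ccontr)
    assume "\<omega> (insert 1 I) \<noteq> 0"
    then have *: "insert 1 I \<subseteq> {1..n}" "card (insert 1 I) = 0" using \<omega> unfolding forms_def by blast+
    from finite_subset[OF *(1)] *(2) show False by simp
  qed
  then show "x1_factor \<omega> I = 0 I" by (simp add: x1_factor_def)
qed

lemma tail_forms_subset: "tail_forms n q \<subseteq> forms n q"
  by (force simp: tail_forms_def forms_def)

lemma mul_var_1_mem:
  assumes "\<omega> \<in> tail_forms n q" "1 \<le> n"
  shows "mul_var 1 \<omega> \<in> forms n (Suc q)"
  unfolding forms_def
proof (intro CollectI allI impI)
  fix I assume "mul_var 1 \<omega> I \<noteq> 0"
  then have I: "1 \<in> I" "\<omega> (I - {1}) \<noteq> 0" by (auto simp: mul_var_def split: if_splits)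
  then have *: "I - {1} \<subseteq> {2..n}" "card (I - {1}) = q"
    using assms(1) unfolding tail_forms_def by blast+
  from finite_subset[OF *(1)] have "finite I" by simp
  from card.remove[OF this I(1)] *(2) have "card I = Suc q" by simp
  moreover have "I \<subseteq> {1..n}" using *(1) assms(2) by auto
  ultimately show "I \<subseteq> {1..n} \<and> card I = Suc q" by simp
qed

lemma x1_split_eqI:
  assumes "a \<in> tail_forms n q" "b \<in> tail_forms n r"
  shows "x1_factor (mul_var 1 a + b) = a" "x1_free_part (mul_var 1 a + b) = b"
proof -
  have *: "a I = 0" "b I = 0" if "1 \<in> I" for I
    using assms that unfolding tail_forms_def by fastforce+
  show "x1_factor (mul_var 1 a + b) = a" "x1_free_part (mul_var 1 a + b) = b"
    using * by (auto simp: fun_eq_iff x1_factor_def x1_free_part_def mul_var_def)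
qed

text \<open>On x_2, ..., x_n the differential is x_1 \<open>shift 1\<close> + x_2
  \<open>shift 2\<close>, and x_1 is closed. On x_1 a only x_1 x_2 \<open>shift 2\<close> a remains,
  since x_1 x_1 = 0. The image x_2 of x_4 under \<open>shift 2\<close> disappears because x_2 x_2 =
  0.\<close>

lemma diff_m2_decompose:
  assumes \<omega>: "\<omega> \<in> forms n q"
  shows "diff n (m2_bracket n) \<omega>
    = mul_var 1 (shift 1 (x1_free_part \<omega>) + mul_var 2 (shift 2 (x1_factor \<omega>)))
      + mul_var 2 (shift 2 (x1_free_part \<omega>))"
proof
  fix I
  have supp: "J \<subseteq> {1..n}" if "\<omega> J \<noteq> 0" for J
    using \<omega> that unfolding forms_def by blast
  have bad: "\<omega> J = 0" if "\<not> (finite J \<and> J \<subseteq> {1..})" for J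
  proof (rule ccontr)
    assume "\<omega> J \<noteq> 0"
    from supp[OF this] have "finite J \<and> J \<subseteq> {1..}" by (auto intro: finite_subset)
    then show False using that by simp
  qed
  define G where "G r = (if r \<in> I
    then \<Sum>i\<in>{i \<in> I. r < i \<and> i + r \<notin> I}. \<omega> (insert (i + r) (I - {r, i})) else 0)" for r
  let ?R = "\<lambda>I. (mul_var 1 (shift 1 (x1_free_part \<omega>) + mul_var 2 (shift 2 (x1_factor \<omega>)))
      + mul_var 2 (shift 2 (x1_free_part \<omega>))) I"
  have "diff n (m2_bracket n) \<omega> I = G 1 + G 2"
    unfolding diff_m2[OF \<omega>] G_def by simp
  also have "\<dots> = ?R I"
  proof (cases "finite I \<and> I \<subseteq> {1..}")
    \<comment> \<open>Sets that are infinite or contain 0: the left side vanishes because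
      \<open>\<omega>\<close> does, the right side by the guard in \<open>shift\<close>.\<close>
    case False
    have "\<omega> (insert (i + r) (I - {r, i})) = 0" if "0 < r" "r < i" for r i
    proof (rule bad)
      from False show "\<not> (finite (insert (i + r) (I - {r, i})) \<and> insert (i + r) (I - {r, i}) \<subseteq> {1..})"
        using that by (auto simp: subset_iff Suc_le_eq)
    qed
    then have "G r = 0" if "r > 0" for r unfolding G_def using that by (auto intro!: sum.neutral)
    then have "G 1 = 0" "G 2 = 0" by simp_all
    moreover have bad': "\<not> (finite (I - A) \<and> I - A \<subseteq> {2..})" if "A \<subseteq> {1, 2}" for A
    proof
      assume *: "finite (I - A) \<and> I - A \<subseteq> {2..}"
      have "finite A" using that by (rule finite_subset) simp
      with * have "finite I" by simp
      moreover have "k \<in> {1..}" if "k \<in> I" for k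
      proof (cases "k \<in> A")
        case True
        then show ?thesis using \<open>A \<subseteq> {1, 2}\<close> by auto
      next
        case False
        then have "k \<in> {2..}" using that * by blast
        then show ?thesis by simp
      qed
      ultimately show False using False by blast
    qed
    then have "shift r \<alpha> (I - A) = 0" if "A \<subseteq> {1, 2}" for A r \<alpha>
      using bad'[OF that] by (simp only: shift_def if_False)
    from this[of "{1}"] this[of "{2}"] this[of "{1, 2}"] have "?R I = 0"
      by (simp add: mul_var_def Diff_insert[symmetric] insert_commute)
    ultimately show ?thesis by simp
  next
    case True
    have "G 1 = mul_var 1 (shift 1 (x1_free_part \<omega>)) I"
    proof (cases "1 \<in> I")
      case 1: True
      have g: "finite (I - {1}) \<and> I - {1} \<subseteq> {2..}" using True by auto
      have "G 1 = (\<Sum>i\<in>{i \<in> I - {1}. i + 1 \<notin> I - {1}}. x1_free_part \<omega> (insert (i + 1) (I - {1} - {i})))"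
        unfolding G_def using 1 True
        by (auto simp: x1_free_part_def Diff_insert[symmetric] insert_commute intro!: sum.cong)
      then show ?thesis using 1 g by (simp add: mul_var_def shift_def)
    qed (simp add: G_def mul_var_def)
    moreover have "G 2 = mul_var 1 (mul_var 2 (shift 2 (x1_factor \<omega>))) I + mul_var 2 (shift 2 (x1_free_part \<omega>)) I"
    proof (cases "2 \<in> I")
      case 2: True
      show ?thesis
      proof (cases "1 \<in> I")
        case 1: True
        have g: "finite (I - {1} - {2}) \<and> I - {1} - {2} \<subseteq> {2..}" using True by auto
        have "G 2 = (\<Sum>i\<in>{i \<in> I - {1} - {2}. i + 2 \<notin> I - {1} - {2}}.
            x1_factor \<omega> (insert (i + 2) (I - {1} - {2} - {i})))"
          unfolding G_def using 2
        proof (simp only: if_True, intro sum.cong)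
          show "{i \<in> I. 2 < i \<and> i + 2 \<notin> I} = {i \<in> I - {1} - {2}. i + 2 \<notin> I - {1} - {2}}"
            using True by auto
          fix i assume i: "i \<in> {i \<in> I - {1} - {2}. i + 2 \<notin> I - {1} - {2}}"
          then have "insert 1 (insert (i + 2) (I - {1} - {2} - {i})) = insert (i + 2) (I - {2, i})"
            using 1 by auto
          then show "\<omega> (insert (i + 2) (I - {2, i})) = x1_factor \<omega> (insert (i + 2) (I - {1} - {2} - {i}))"
            by (simp add: x1_factor_def)
        qed
        moreover have "shift 2 (x1_free_part \<omega>) (I - {2}) = 0"
          using 1 by (auto simp: shift_def)
        ultimately show ?thesis using 1 2 g by (simp add: mul_var_def shift_def)
      next
        case 1: False
        have I2: "I \<subseteq> {2..}"
        proof
          fix k assume "k \<in> I"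
          then have "k \<noteq> 1" "k \<in> {1..}" using 1 True by auto
          then show "k \<in> {2..}" by simp
        qed
        then have g: "finite (I - {2}) \<and> I - {2} \<subseteq> {2..}" using True by auto
        have "G 2 = (\<Sum>i\<in>{i \<in> I - {2}. i + 2 \<notin> I - {2}}. x1_free_part \<omega> (insert (i + 2) (I - {2} - {i})))"
          unfolding G_def using 2
        proof (simp only: if_True, intro sum.cong)
          show "{i \<in> I. 2 < i \<and> i + 2 \<notin> I} = {i \<in> I - {2}. i + 2 \<notin> I - {2}}"
            using I2 by auto
          fix i assume "i \<in> {i \<in> I - {2}. i + 2 \<notin> I - {2}}"
          have "I - {2} - {i} = I - {2, i}" by auto
          then show "\<omega> (insert (i + 2) (I - {2, i})) = x1_free_part \<omega> (insert (i + 2) (I - {2} - {i}))"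
            using 1 by (simp add: x1_free_part_def)
        qed
        then show ?thesis using 1 2 g by (simp add: mul_var_def shift_def)
      qed
    qed (simp add: G_def mul_var_def)
    ultimately show ?thesis by (simp add: mul_var_add add.assoc)
  qed
  finally show "diff n (m2_bracket n) \<omega> I = ?R I" .
qed


text \<open>
  With \<open>D = shift 1\<close>, the differential is \<open>x\<^sub>1 a + b \<mapsto> x\<^sub>1 (D b + x\<^sub>2 D\<^sup>2 a) + x\<^sub>2 D\<^sup>2 b\<close>, which in the
  coordinates \<open>a\<close> and \<open>y = b + x\<^sub>2 D a\<close> becomes \<open>(a, y) \<mapsto> (D y, 0)\<close>.
\<close>

definition untwist :: "form2 \<Rightarrow> form2" where
  "untwist \<omega> = x1_free_part \<omega> + mul_var 2 (shift 1 (x1_factor \<omega>))"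

text \<open>The form with coordinates a = c and y = 0: in characteristic 2, b + x_2 D c = 0 means b
  = x_2 D c.\<close>

definition twist :: "form2 \<Rightarrow> form2" where
  "twist c = mul_var 1 c + mul_var 2 (shift 1 c)"

definition kernel_forms :: "nat \<Rightarrow> nat \<Rightarrow> form2 set" where
  "kernel_forms n q = {\<omega> \<in> tail_forms n q. shift 1 \<omega> = 0}"

lemma untwist_mem:
  assumes "\<omega> \<in> forms n q" "2 \<le> n"
  shows "untwist \<omega> \<in> tail_forms n q"
proof (cases q)
  case 0
  then show ?thesis
    using assms x1_free_part_mem[OF assms(1)] x1_factor_0[of \<omega> n]
    by (simp add: untwist_def tail_forms_add)
next
  case (Suc r)
  then show ?thesis
    using assms by (auto simp: untwist_def intro!: tail_forms_add x1_free_part_mem mul_var_tail_forms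
        shift_tail_forms x1_factor_mem)
qed

text \<open>Since D^2 = \<open>shift 2\<close> and D commutes with x_2, D y = D b + x_2 D^2 a, and
  x_2 D (D y) = x_2 D^2 b because x_2 x_2 = 0.\<close>

lemma diff_m2_untwist:
  assumes "\<omega> \<in> forms n q"
  shows "diff n (m2_bracket n) \<omega> = twist (shift 1 (untwist \<omega>))"
proof -
  have "shift 1 (shift 1 \<alpha>) = shift 2 \<alpha>" for \<alpha> by (subst shift_shift) simp_all
  then show ?thesis
    by (simp add: diff_m2_decompose[OF assms] twist_def untwist_def shift_add shift_mul_var mul_var_add
        del: One_nat_def)
qed

text \<open>\<open>untwist (twist c) = 0\<close> is d d = 0 in these coordinates, and
  \<open>x1_factor\<close> is a left inverse of \<open>twist\<close>.\<close>

lemma tail_form_twist: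
  assumes "c \<in> tail_forms n q" "2 \<le> n"
  shows "twist c \<in> forms n (Suc q)" "x1_factor (twist c) = c" "untwist (twist c) = 0"
proof -
  have m: "mul_var 2 (shift 1 c) \<in> tail_forms n (Suc q)"
    using assms by (intro mul_var_tail_forms shift_tail_forms)
  show "twist c \<in> forms n (Suc q)"
    unfolding twist_def
    using assms m tail_forms_subset by (intro forms_plus mul_var_1_mem) auto
  show "x1_factor (twist c) = c" "untwist (twist c) = 0"
    using x1_split_eqI[OF assms(1) m] by (simp_all add: twist_def untwist_def)
qed

lemma twist_eq_0_iff:
  assumes "c \<in> tail_forms n q" "2 \<le> n"
  shows "twist c = 0 \<longleftrightarrow> c = 0"
proof
  assume "twist c = 0"
  then have "x1_factor (twist c) = 0" by (simp add: x1_factor_def fun_eq_iff)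
  then show "c = 0" using tail_form_twist(2)[OF assms] by simp
qed (simp add: twist_def)

section \<open>Cocycles and coboundaries in the new coordinates\<close>

lemma cocycles_m2:
  assumes "2 \<le> n"
  shows "cocycles n (m2_bracket n) q = {\<omega> \<in> forms n q. untwist \<omega> \<in> kernel_forms n q}"
proof -
  have "twist (shift 1 (untwist \<omega>)) = (\<lambda>I. 0) \<longleftrightarrow> untwist \<omega> \<in> kernel_forms n q"
    if "\<omega> \<in> forms n q" for \<omega>
    using twist_eq_0_iff[OF shift_tail_forms[OF untwist_mem[OF that assms]] assms] untwist_mem[OF that assms]
    by (simp add: kernel_forms_def zero_fun_def)
  then show ?thesis unfolding cocycles_def by (auto simp: diff_m2_untwist)
qed

text \<open>Being a cocycle restricts only the coordinate y; a ranges freely over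
  \<open>tail_forms n q\<close>.\<close>

lemma card_cocycles_m2:
  assumes "2 \<le> n"
  shows "card (cocycles n (m2_bracket n) (Suc q)) = card (tail_forms n q) * card (kernel_forms n (Suc q))"
proof -
  have "bij_betw (\<lambda>\<omega>. (x1_factor \<omega>, untwist \<omega>)) (cocycles n (m2_bracket n) (Suc q))
      (tail_forms n q \<times> kernel_forms n (Suc q))"
  proof (rule bij_betw_byWitness[where f' = "\<lambda>(a, y). mul_var 1 a + (y + mul_var 2 (shift 1 a))"])
    have yx: "y + m + m = y" for y m :: form2 by (simp add: add.assoc)
    show "\<forall>\<omega>\<in>cocycles n (m2_bracket n) (Suc q).
        (case (x1_factor \<omega>, untwist \<omega>) of (a, y) \<Rightarrow> mul_var 1 a + (y + mul_var 2 (shift 1 a))) = \<omega>"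
      by (simp add: untwist_def yx x1_split[symmetric] del: One_nat_def)
    have *: "mul_var 1 a + (y + mul_var 2 (shift 1 a)) \<in> forms n (Suc q)"
      "x1_factor (mul_var 1 a + (y + mul_var 2 (shift 1 a))) = a"
      "untwist (mul_var 1 a + (y + mul_var 2 (shift 1 a))) = y"
      if a: "a \<in> tail_forms n q" and y: "y \<in> tail_forms n (Suc q)" for a y
    proof -
      have b: "y + mul_var 2 (shift 1 a) \<in> tail_forms n (Suc q)"
        using a y assms by (intro tail_forms_add mul_var_tail_forms shift_tail_forms)
      have "1 \<le> n" using assms by simp
      from mul_var_1_mem[OF a this] b
      show "mul_var 1 a + (y + mul_var 2 (shift 1 a)) \<in> forms n (Suc q)"
        using tail_forms_subset by (blast intro: forms_plus)
      show "x1_factor (mul_var 1 a + (y + mul_var 2 (shift 1 a))) = a"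
        "untwist (mul_var 1 a + (y + mul_var 2 (shift 1 a))) = y"
        using x1_split_eqI[OF a b] by (simp_all add: untwist_def yx)
    qed
    show "\<forall>z\<in>tail_forms n q \<times> kernel_forms n (Suc q).
        (x1_factor (case z of (a, y) \<Rightarrow> mul_var 1 a + (y + mul_var 2 (shift 1 a))),
         untwist (case z of (a, y) \<Rightarrow> mul_var 1 a + (y + mul_var 2 (shift 1 a)))) = z"
      using * by (auto simp: kernel_forms_def)
    show "(\<lambda>\<omega>. (x1_factor \<omega>, untwist \<omega>)) ` cocycles n (m2_bracket n) (Suc q)
        \<subseteq> tail_forms n q \<times> kernel_forms n (Suc q)"
      using assms by (auto simp: cocycles_m2 x1_factor_mem)
    show "(\<lambda>(a, y). mul_var 1 a + (y + mul_var 2 (shift 1 a))) ` (tail_forms n q \<times> kernel_forms n (Suc q))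
        \<subseteq> cocycles n (m2_bracket n) (Suc q)"
      using assms * by (auto simp: cocycles_m2 kernel_forms_def)
  qed
  then show ?thesis by (simp add: bij_betw_same_card card_cartesian_product)
qed

lemma coboundaries_m2:
  assumes "2 \<le> n"
  shows "coboundaries n (m2_bracket n) (Suc q) = twist ` shift 1 ` tail_forms n q"
proof -
  \<comment> \<open>Every y is attained, namely by y itself as a form without x_1.\<close>
  have "untwist ` forms n q = tail_forms n q"
  proof (intro equalityI subsetI)
    fix y assume y: "y \<in> tail_forms n q"
    have "untwist y = y"
    proof -
      have "x1_factor (mul_var 1 0 + y) = 0" "x1_free_part (mul_var 1 0 + y) = y"
        using x1_split_eqI[OF tail_forms_zero y] by simp_all
      then show ?thesis by (simp add: untwist_def)
    qed
    then show "y \<in> untwist ` forms n q" using y tail_forms_subset by (metis image_eqI subsetD)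
  qed (use untwist_mem assms in auto)
  moreover have "coboundaries n (m2_bracket n) (Suc q) = twist ` shift 1 ` untwist ` forms n q"
    unfolding coboundaries_def by (simp add: diff_m2_untwist image_image cong: image_cong)
  ultimately show ?thesis by simp
qed

lemma finite_tail_forms [simp]: "finite (tail_forms n q)"
  by (rule finite_subset[OF tail_forms_subset]) simp

lemma card_tail_forms_shift:
  "card (tail_forms n q) = card (shift 1 ` tail_forms n q) * card (kernel_forms n q)"
  unfolding kernel_forms_def
  by (rule card_eq_card_image_times_card_kernel) (auto simp: tail_forms_add shift_add)

text \<open>With T the tail forms and K the kernels, there are |T_q| |K_(q+1)| cocycles and |D T_q|
  coboundaries; rank-nullity |T_q| = |D T_q| |K_q| leaves |K_(q+1)| |K_q|.\<close>

lemma two_power_betti_m2: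
  assumes "2 \<le> n"
  shows "2 ^ betti n (m2_bracket n) (Suc q) = card (kernel_forms n (Suc q)) * card (kernel_forms n q)"
proof -
  let ?B = "coboundaries n (m2_bracket n) (Suc q)" and ?Z = "cocycles n (m2_bracket n) (Suc q)"
  have "?B \<subseteq> ?Z"
    using assms by (auto simp: coboundaries_m2 cocycles_m2 tail_form_twist[OF shift_tail_forms] kernel_forms_def)
  then have "2 ^ betti n (m2_bracket n) (Suc q) * card ?B = card ?Z" by (rule two_power_betti)
  moreover have "card ?B = card (shift 1 ` tail_forms n q)"
    unfolding coboundaries_m2[OF assms]
    by (rule card_image, rule inj_on_inverseI[where g = x1_factor])
      (auto simp: tail_form_twist[OF shift_tail_forms] assms)
  moreover have "tail_forms n q \<noteq> {}" using tail_forms_zero by blast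
  ultimately show ?thesis
    using card_cocycles_m2[OF assms, of q] card_tail_forms_shift[of n q]
    by (simp add: mult.commute mult.left_commute)
qed

section \<open>The kernel of \<open>D\<close> in degrees at most two\<close>

lemma card_tail_forms: "card (tail_forms n q) = 2 ^ ((n - 1) choose q)"
proof -
  let ?S = "{B. B \<subseteq> {2..n} \<and> card B = q}"
  have "tail_forms n q = {\<omega>. \<forall>I. \<omega> I \<noteq> 0 \<longrightarrow> I \<in> ?S}"
    by (simp add: tail_forms_def)
  also have "card \<dots> = 2 ^ card ?S" by (rule card_bit_functions) simp
  also have "card ?S = (n - 1) choose q" by (subst n_subsets) simp_all
  finally show ?thesis .
qed

lemma card_kernel_forms_0: "card (kernel_forms n 0) = 2"
proof -
  have "shift 1 \<omega> = 0" if \<omega>: "\<omega> \<in> tail_forms n 0" for \<omega>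
  proof
    fix I
    show "shift 1 \<omega> I = 0 I"
    proof (rule ccontr)
      assume "shift 1 \<omega> I \<noteq> 0 I"
      with shift_tail_forms[OF \<omega>, of 1] have *: "I \<subseteq> {2..n}" "card I = 0"
        unfolding tail_forms_def by auto
      from finite_subset[OF *(1)] *(2) have "I = {}" by simp
      then show False using \<open>shift 1 \<omega> I \<noteq> 0 I\<close> by (simp add: shift_def)
    qed
  qed
  then have "kernel_forms n 0 = tail_forms n 0" by (auto simp: kernel_forms_def)
  then show ?thesis by (simp add: card_tail_forms)
qed

text \<open>In degree one D is a single nilpotent Jordan block, whose kernel is spanned by
  x_2.\<close>

lemma card_kernel_forms_1:
  assumes "2 \<le> n"
  shows "card (kernel_forms n 1) = 2"
proof -
  have sing: "shift 1 \<omega> {i} = \<omega> {i + 1}" if "2 \<le> i" for \<omega> i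
  proof -
    have "{j \<in> {i}. j + 1 \<notin> {i}} = {i}" by auto
    then show ?thesis using that by (simp add: shift_def)
  qed
  have "kernel_forms n 1 = {\<omega>. \<forall>I. \<omega> I \<noteq> 0 \<longrightarrow> I \<in> {{2}}}"
  proof (intro equalityI subsetI CollectI allI impI)
    fix \<omega> I assume \<omega>: "\<omega> \<in> kernel_forms n 1" and I: "\<omega> I \<noteq> 0"
    from \<omega> I have "I \<subseteq> {2..n}" "card I = 1" unfolding kernel_forms_def tail_forms_def by blast+
    then obtain i where i: "I = {i}" "2 \<le> i" by (auto simp: card_1_singleton_iff)
    have "i = 2"
    proof (rule ccontr)
      assume "i \<noteq> 2"
      with i have "\<omega> {i - 1 + 1} = 0" using sing[of "i - 1" \<omega>] \<omega> by (simp add: kernel_forms_def)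
      then show False using i I by simp
    qed
    then show "I \<in> {{2}}" using i by simp
  next
    fix \<omega> :: form2 assume "\<omega> \<in> {\<omega>. \<forall>I. \<omega> I \<noteq> 0 \<longrightarrow> I \<in> {{2}}}"
    then have \<omega>: "\<omega> I \<noteq> 0 \<Longrightarrow> I = {2}" for I by blast
    then have t: "\<omega> \<in> tail_forms n 1" using assms by (force simp: tail_forms_def)
    have "shift 1 \<omega> I = 0" for I
    proof (rule ccontr)
      assume ne: "shift 1 \<omega> I \<noteq> 0"
      with shift_tail_forms[OF t, of 1] have "I \<subseteq> {2..n}" "card I = 1"
        unfolding tail_forms_def by blast+
      then obtain i where i: "I = {i}" "2 \<le> i" by (auto simp: card_1_singleton_iff)
      with ne sing have "\<omega> {i + 1} \<noteq> 0" by simp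
      from \<omega>[OF this] i(2) show False by simp
    qed
    then show "\<omega> \<in> kernel_forms n 1" using t by (simp add: kernel_forms_def fun_eq_iff)
  qed
  then show ?thesis using card_bit_functions(2)[of "{{2::nat}}"] by simp
qed

text \<open>Numbering from 0 and a zero diagonal give a symmetric matrix whose kernel equations have
  no exceptions for colliding indices.\<close>

definition coef2 :: "form2 \<Rightarrow> nat \<Rightarrow> nat \<Rightarrow> bit" where
  "coef2 \<omega> i j = (if i \<noteq> j then \<omega> {i + 2, j + 2} else 0)"

lemma coef2_commute: "coef2 \<omega> i j = coef2 \<omega> j i"
  by (simp add: coef2_def insert_commute)

lemma shift_pair:
  assumes "a \<noteq> b" "2 \<le> a" "2 \<le> b"
  shows "shift 1 \<omega> {a, b}
    = (if a + 1 = b then 0 else \<omega> {a + 1, b}) + (if b + 1 = a then 0 else \<omega> {a, b + 1})"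
proof -
  have "shift 1 \<omega> {a, b} = (\<Sum>i\<in>{i \<in> {a, b}. i + 1 \<notin> {a, b}}. \<omega> (insert (i + 1) ({a, b} - {i})))"
    using assms by (simp add: shift_def)
  also have "\<dots> = (\<Sum>i\<in>{a, b}. if i + 1 \<notin> {a, b} then \<omega> (insert (i + 1) ({a, b} - {i})) else 0)"
    by (rule sum.inter_filter) simp
  also have "\<dots> = (if a + 1 = b then 0 else \<omega> {a + 1, b}) + (if b + 1 = a then 0 else \<omega> {a, b + 1})"
  proof -
    have "{a, b} - {a} = {b}" "{a, b} - {b} = {a}" using assms by auto
    then show ?thesis using assms(1) by (simp add: insert_commute)
  qed
  finally show ?thesis .
qed

text \<open>The two terms add up to the coefficient of D \<open>\<omega>\<close> at {i + 2, j + 2};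
  a raised index that hits the other one falls on the zero diagonal.\<close>

lemma coef2_kernel:
  assumes "\<omega> \<in> kernel_forms n 2"
  shows "coef2 \<omega> (Suc i) j = coef2 \<omega> i (Suc j)"
proof (cases "i = j")
  case False
  have "shift 1 \<omega> {i + 2, j + 2} = 0" using assms by (simp add: kernel_forms_def)
  then have "coef2 \<omega> (Suc i) j + coef2 \<omega> i (Suc j) = 0"
    using False by (subst (asm) shift_pair) (auto simp: coef2_def)
  then show ?thesis by (simp add: bit_add_eq_0_iff)
qed (simp add: coef2_commute)

lemma antidiagonal_constant:
  assumes "\<And>i j. b (Suc i) j = b i (Suc j)"
  shows "b (i + s) j = b i (j + s)"
  by (induction s arbitrary: i j) (simp_all add: assms)

text \<open>Every antidiagonal meets the diagonal or the one next to it, according to the parity of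
  i + j.\<close>

lemma antidiagonal_eq_0:
  fixes b :: "nat \<Rightarrow> nat \<Rightarrow> bit"
  assumes step: "\<And>i j. b (Suc i) j = b i (Suc j)" and comm: "\<And>i j. b i j = b j i"
    and diag: "\<And>i. b i i = 0" and next_diag: "\<And>i. b i (Suc i) = 0"
  shows "b i j = 0"
proof -
  note a = antidiagonal_constant[of b, OF step]
  have le: "b i (i + d) = 0" for i d
  proof (cases "even d")
    case True
    then obtain e where "d = e + e" by (auto elim!: evenE simp: mult_2)
    then show ?thesis using a[of i e "i + e"] diag[of "i + e"] by (simp add: add.assoc)
  next
    case False
    then obtain e where "d = Suc (e + e)" by (auto elim!: oddE simp: mult_2)
    then show ?thesis using a[of i e "Suc (i + e)"] next_diag[of "i + e"] by (simp add: add.assoc)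
  qed
  show ?thesis
  proof (cases "i \<le> j")
    case True
    then show ?thesis using le[of i "j - i"] by simp
  next
    case False
    then show ?thesis using le[of j "i - j"] comm[of i j] by simp
  qed
qed

text \<open>An element is determined by its entries (a, a + 1), one for each odd antidiagonal 2a +
  1. A nonzero antidiagonal must fit into the square of size n - 1, which leaves a < (n - 1) div
  2.\<close>

lemma card_kernel_forms_2:
  assumes n: "2 \<le> n"
  shows "card (kernel_forms n 2) = 2 ^ ((n - 1) div 2)"
proof -
  define h where "h = (n - 1) div 2"
  define F where "F \<omega> = (\<lambda>a. coef2 \<omega> a (Suc a))" for \<omega>
  define S where "S = {f :: nat \<Rightarrow> bit. \<forall>a. f a \<noteq> 0 \<longrightarrow> a \<in> {..<h}}"
  have pair: "\<exists>i j. I = {i + 2, j + 2} \<and> i < j" if "I \<subseteq> {2..}" "card I = 2" for I :: "nat set"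
  proof -
    from that(2) obtain a b where ab: "I = {a, b}" "a \<noteq> b" by (auto simp: card_2_iff)
    then have "2 \<le> a" "2 \<le> b" using that(1) by auto
    then have I: "I = {(a - 2) + 2, (b - 2) + 2}" "I = {(b - 2) + 2, (a - 2) + 2}"
      using ab by auto
    have "a - 2 < b - 2 \<or> b - 2 < a - 2" using \<open>2 \<le> a\<close> \<open>2 \<le> b\<close> ab(2) by linarith
    then show ?thesis using I by blast
  qed
  have supp: "coef2 \<omega> i j = 0" if "\<omega> \<in> kernel_forms n 2" "n - 1 \<le> j" for \<omega> i j
  proof -
    have "\<not> {i + 2, j + 2} \<subseteq> {2..n}" using that(2) n by auto
    then have "\<omega> {i + 2, j + 2} = 0" using that(1) unfolding kernel_forms_def tail_forms_def by blast
    then show ?thesis by (simp add: coef2_def)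
  qed
  have "{\<omega> \<in> kernel_forms n 2. F \<omega> = 0} = {0}"
  proof (intro equalityI subsetI)
    fix \<omega> assume "\<omega> \<in> {\<omega> \<in> kernel_forms n 2. F \<omega> = 0}"
    then have \<omega>: "\<omega> \<in> kernel_forms n 2" and F: "coef2 \<omega> a (Suc a) = 0" for a
      by (auto simp: F_def fun_eq_iff)
    have z: "coef2 \<omega> i j = 0" for i j
      by (rule antidiagonal_eq_0[of "coef2 \<omega>", OF coef2_kernel[OF \<omega>] coef2_commute _ F]) (simp add: coef2_def)
    have "\<omega> I = 0" for I
    proof (rule ccontr)
      assume I: "\<omega> I \<noteq> 0"
      with \<omega> have "I \<subseteq> {2..n}" "card I = 2" unfolding kernel_forms_def tail_forms_def by blast+
      then obtain i j where "I = {i + 2, j + 2}" "i < j" using pair[of I] by force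
      then show False using I z[of i j] by (simp add: coef2_def)
    qed
    then show "\<omega> \<in> {0}" by (simp add: fun_eq_iff)
  next
    fix \<omega> :: form2 assume "\<omega> \<in> {0}"
    then have "\<omega> = 0" by simp
    moreover have "F 0 = 0" by (simp add: F_def fun_eq_iff coef2_def)
    ultimately show "\<omega> \<in> {\<omega> \<in> kernel_forms n 2. F \<omega> = 0}" by (simp add: kernel_forms_def)
  qed
  moreover have "F ` kernel_forms n 2 = S"
  proof (intro equalityI subsetI)
    fix f assume "f \<in> F ` kernel_forms n 2"
    then obtain \<omega> where \<omega>: "\<omega> \<in> kernel_forms n 2" "f = F \<omega>" by auto
    have "f a = 0" if "h \<le> a" for a
    proof -
      \<comment> \<open>Follow the antidiagonal to the edge: 2a + 1 >= n - 1 once a >= h.\<close>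
      have "f a = coef2 \<omega> 0 (Suc a + a)"
        using antidiagonal_constant[of "coef2 \<omega>" 0 a "Suc a", OF coef2_kernel[OF \<omega>(1)]]
        by (simp add: \<omega>(2) F_def)
      also have "\<dots> = 0" by (rule supp[OF \<omega>(1)]) (use that in \<open>simp add: h_def\<close>)
      finally show ?thesis .
    qed
    then have "a \<in> {..<h}" if "f a \<noteq> 0" for a using that by (meson lessThan_iff not_le)
    then show "f \<in> S" unfolding S_def by blast
  next
    fix f assume "f \<in> S"
    then have f: "f a = 0" if "h \<le> a" for a using that by (auto simp: S_def)
    \<comment> \<open>Constant on odd antidiagonals and zero on even ones; for i + j = 2a + 1 the
      sum of the indices is 2a + 5.\<close>
    define \<omega> where "\<omega> I = (if I \<subseteq> {2..n} \<and> card I = 2 \<and> odd (\<Sum>I) then f ((\<Sum>I - 5) div 2) else 0)" for I :: "nat set"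
    have t: "\<omega> \<in> tail_forms n 2" unfolding tail_forms_def \<omega>_def by auto
    have c: "\<omega> {i + 2, j + 2} = (if j + 2 \<le> n \<and> odd (i + j) then f ((i + j - 1) div 2) else 0)" if "i < j" for i j
    proof -
      have "{i + 2, j + 2} \<subseteq> {2..n} \<longleftrightarrow> j + 2 \<le> n" using that by auto
      moreover have "\<Sum>{i + 2, j + 2} = i + j + 4" "card {i + 2, j + 2} = 2" using that by auto
      ultimately show ?thesis by (simp add: \<omega>_def)
    qed
    have "shift 1 \<omega> I = 0" for I
    proof (rule ccontr)
      assume ne: "shift 1 \<omega> I \<noteq> 0"
      with shift_tail_forms[OF t, of 1] have I: "I \<subseteq> {2..n}" "card I = 2"
        unfolding tail_forms_def by blast+
      then obtain i j where ij: "I = {i + 2, j + 2}" "i < j" using pair[of I] by force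
      with I have j: "j + 2 \<le> n" by auto
      have *: "shift 1 \<omega> I = (if Suc i = j then 0 else \<omega> {Suc i + 2, j + 2}) + \<omega> {i + 2, Suc j + 2}"
        using ij by (subst ij(1), subst shift_pair) auto
      show False
      proof (cases "Suc i = j")
        case True
        then show False using ne * c[of i "Suc j"] by (simp add: True[symmetric])
      next
        case False
        then have "Suc i < j" using ij(2) by simp
        then have **: "shift 1 \<omega> I = (if odd (Suc i + j) then f ((i + j) div 2) else 0)
            + (if Suc j + 2 \<le> n \<and> odd (Suc i + j) then f ((i + j) div 2) else 0)"
          using * c[of "Suc i" j] c[of i "Suc j"] False ij(2) j by simp
        \<comment> \<open>At the edge j + 2 = n one of the two cancelling terms leaves the range;
          the other belongs to an antidiagonal with number at least h, where f is zero.\<close>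
        have "f ((i + j) div 2) = 0" if edge: "\<not> Suc j + 2 \<le> n" "odd (Suc i + j)"
        proof (rule f)
          have "n = j + 2" using edge(1) j by simp
          moreover have "even (i + j)" using edge(2) by simp
          ultimately show "h \<le> (i + j) div 2" unfolding h_def by presburger
        qed
        then show False using ne ** by (auto split: if_splits)
      qed
    qed
    then have k: "\<omega> \<in> kernel_forms n 2" using t by (simp add: kernel_forms_def fun_eq_iff)
    have "F \<omega> a = f a" for a
    proof -
      have "F \<omega> a = (if Suc a + 2 \<le> n then f a else 0)"
        using c[of a "Suc a"] by (simp add: F_def coef2_def)
      moreover have "f a = 0" if "\<not> Suc a + 2 \<le> n"
        by (rule f) (use that n in \<open>simp add: h_def\<close>)
      ultimately show ?thesis by auto
    qed
    then have "f = F \<omega>" by auto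
    then show "f \<in> F ` kernel_forms n 2" using k by blast
  qed
  moreover have "card (kernel_forms n 2) = card (F ` kernel_forms n 2) * card {\<omega> \<in> kernel_forms n 2. F \<omega> = 0}"
    by (rule card_eq_card_image_times_card_kernel)
      (auto simp: kernel_forms_def tail_forms_add shift_add F_def coef2_def fun_eq_iff)
  moreover have "card S = 2 ^ h"
    unfolding S_def by (subst card_bit_functions) simp_all
  ultimately show ?thesis by (simp add: h_def)
qed


section \<open>The kernel of \<open>D\<close> in degree three\<close>

definition coef3 :: "form2 \<Rightarrow> nat \<Rightarrow> nat \<Rightarrow> nat \<Rightarrow> bit" where
  "coef3 \<omega> i j k = (if i \<noteq> j \<and> i \<noteq> k \<and> j \<noteq> k then \<omega> {i + 2, j + 2, k + 2} else 0)"

lemma coef3_commute: "coef3 \<omega> i j k = coef3 \<omega> j i k" "coef3 \<omega> i j k = coef3 \<omega> i k j"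
  by (auto simp: coef3_def insert_commute)

lemma coef3_diag [simp]: "coef3 \<omega> i i k = 0" "coef3 \<omega> i k k = 0" "coef3 \<omega> i k i = 0"
  by (simp_all add: coef3_def)

lemma coef3_add: "coef3 (\<alpha> + \<beta>) i j k = coef3 \<alpha> i j k + coef3 \<beta> i j k"
  by (simp add: coef3_def)

text \<open>With n = N + 1 there are N variables, numbered 0 to N - 1.\<close>

lemma coef3_eq_0:
  assumes "\<omega> \<in> tail_forms (Suc N) q" "N \<le> i \<or> N \<le> j \<or> N \<le> k"
  shows "coef3 \<omega> i j k = 0"
proof -
  have "\<not> {i + 2, j + 2, k + 2} \<subseteq> {2..Suc N}" using assms(2) by auto
  then have "\<omega> {i + 2, j + 2, k + 2} = 0" using assms(1) unfolding tail_forms_def by blast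
  then show ?thesis by (simp add: coef3_def)
qed

lemma shift_triple:
  assumes "a \<noteq> b" "a \<noteq> c" "b \<noteq> c" "2 \<le> a" "2 \<le> b" "2 \<le> c"
  shows "shift 1 \<omega> {a, b, c}
    = (if a + 1 \<in> {b, c} then 0 else \<omega> {a + 1, b, c})
    + (if b + 1 \<in> {a, c} then 0 else \<omega> {a, b + 1, c})
    + (if c + 1 \<in> {a, b} then 0 else \<omega> {a, b, c + 1})"
proof -
  let ?I = "{a, b, c}"
  have "shift 1 \<omega> ?I = (\<Sum>i\<in>{i \<in> ?I. i + 1 \<notin> ?I}. \<omega> (insert (i + 1) (?I - {i})))"
    using assms by (simp add: shift_def)
  also have "\<dots> = (\<Sum>i\<in>?I. if i + 1 \<notin> ?I then \<omega> (insert (i + 1) (?I - {i})) else 0)"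
    by (rule sum.inter_filter) simp
  also have "\<dots> = (if a + 1 \<in> {b, c} then 0 else \<omega> {a + 1, b, c})
    + (if b + 1 \<in> {a, c} then 0 else \<omega> {a, b + 1, c})
    + (if c + 1 \<in> {a, b} then 0 else \<omega> {a, b, c + 1})"
  proof -
    have "?I - {a} = {b, c}" "?I - {b} = {a, c}" "?I - {c} = {a, b}" using assms by auto
    then show ?thesis using assms(1-3) by (simp add: insert_commute add.assoc)
  qed
  finally show ?thesis .
qed

text \<open>The coefficient of D \<open>\<omega>\<close> at the three indices, solved for its first
  term; where indices coincide, symmetry and the zero diagonals give the relation.\<close>

lemma coef3_kernel:
  assumes "\<omega> \<in> kernel_forms n 3"
  shows "coef3 \<omega> (Suc i) j k = coef3 \<omega> i (Suc j) k + coef3 \<omega> i j (Suc k)"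
proof (cases "i = j \<or> i = k \<or> j = k")
  case True
  then show ?thesis
    using coef3_commute[of \<omega> "Suc i" i] coef3_commute[of \<omega> "Suc k" k]
      coef3_commute[of \<omega> k "Suc k" k] coef3_commute[of \<omega> i "Suc j" j] coef3_commute[of \<omega> i j "Suc i"]
      coef3_commute[of \<omega> j i "Suc i"] coef3_commute[of \<omega> "Suc i" i j] coef3_commute[of \<omega> j "Suc i" i]
    by auto
next
  case False
  have c: "coef3 \<omega> (Suc i) j k = (if i + 2 + 1 \<in> {j + 2, k + 2} then 0 else \<omega> {i + 2 + 1, j + 2, k + 2})"
    "coef3 \<omega> i (Suc j) k = (if j + 2 + 1 \<in> {i + 2, k + 2} then 0 else \<omega> {i + 2, j + 2 + 1, k + 2})"
    "coef3 \<omega> i j (Suc k) = (if k + 2 + 1 \<in> {i + 2, j + 2} then 0 else \<omega> {i + 2, j + 2, k + 2 + 1})"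
    using False by (simp_all add: coef3_def eq_commute)
  have "coef3 \<omega> (Suc i) j k + coef3 \<omega> i (Suc j) k + coef3 \<omega> i j (Suc k)
      = shift 1 \<omega> {i + 2, j + 2, k + 2}"
    unfolding c by (rule shift_triple[symmetric]) (use False in auto)
  also have "\<dots> = 0" using assms by (simp add: kernel_forms_def)
  finally show ?thesis by (simp add: bit_add_eq_0_iff add.assoc)
qed

text \<open>Two steps of size P produce the mixed term at (i, j + P, k + P) twice; it cancels, and
  the relation holds with step 2P.\<close>

lemma coef3_shift_power:
  assumes "\<omega> \<in> kernel_forms n 3"
  shows "coef3 \<omega> (i + 2 ^ p) j k = coef3 \<omega> i (j + 2 ^ p) k + coef3 \<omega> i j (k + 2 ^ p)"
proof (induction p arbitrary: i j k)
  case 0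
  then show ?case using coef3_kernel[OF assms] by simp
next
  case (Suc p)
  have cancel: "x + y + (y + z) = x + z" for x y z :: bit
    by (cases x; cases y; cases z) simp_all
  have "coef3 \<omega> (i + 2 ^ Suc p) j k = coef3 \<omega> (i + 2 ^ p + 2 ^ p) j k" by (simp add: mult_2 add.assoc)
  also have "\<dots> = coef3 \<omega> i (j + 2 ^ p + 2 ^ p) k + coef3 \<omega> i j (k + 2 ^ p + 2 ^ p)"
    unfolding Suc by (rule cancel)
  finally show ?case by (simp add: mult_2 add.assoc)
qed

text \<open>All binomial coefficients \<open>2\<^sup>p - 1\<close> over \<open>s\<close> are odd.\<close>

lemma coef3_shift_pred_power:
  assumes "\<omega> \<in> kernel_forms n 3"
  shows "coef3 \<omega> (i + (2 ^ p - 1)) j k = (\<Sum>s<2 ^ p. coef3 \<omega> i (j + s) (k + (2 ^ p - 1 - s)))"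
proof (induction p arbitrary: i j k)
  case (Suc p)
  let ?P = "2 ^ p :: nat"
  have P: "?P > 0" by simp
  have "i + (2 ^ Suc p - 1) = i + ?P + (?P - 1)" using P by simp
  then have "coef3 \<omega> (i + (2 ^ Suc p - 1)) j k
      = (\<Sum>s<?P. coef3 \<omega> (i + ?P) (j + s) (k + (?P - 1 - s)))"
    using Suc by presburger
  also have "\<dots> = (\<Sum>s<?P. coef3 \<omega> i (j + (s + ?P)) (k + (?P - 1 - s)))
      + (\<Sum>s<?P. coef3 \<omega> i (j + s) (k + (?P - 1 - s) + ?P))"
    unfolding coef3_shift_power[OF assms] by (simp add: sum.distrib add.assoc)
  \<comment> \<open>These terms form the upper half of the sum for p + 1; the terms that raise k
    form the lower half.\<close>
  also have "(\<Sum>s<?P. coef3 \<omega> i (j + (s + ?P)) (k + (?P - 1 - s)))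
      = (\<Sum>s\<in>{?P..<2 ^ Suc p}. coef3 \<omega> i (j + s) (k + (2 ^ Suc p - 1 - s)))"
    by (rule sum.reindex_bij_witness[where i = "\<lambda>s. s - ?P" and j = "\<lambda>s. s + ?P"])
      (auto simp: less_diff_conv2 intro!: arg_cong[where f = "coef3 \<omega> i _"])
  also have "(\<Sum>s<?P. coef3 \<omega> i (j + s) (k + (?P - 1 - s) + ?P))
      = (\<Sum>s<?P. coef3 \<omega> i (j + s) (k + (2 ^ Suc p - 1 - s)))"
    by (rule sum.cong) (auto intro!: arg_cong[where f = "coef3 \<omega> i _"])
  also have "(\<Sum>s\<in>{?P..<2 ^ Suc p}. coef3 \<omega> i (j + s) (k + (2 ^ Suc p - 1 - s)))
      + (\<Sum>s<?P. coef3 \<omega> i (j + s) (k + (2 ^ Suc p - 1 - s)))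
      = (\<Sum>s<2 ^ Suc p. coef3 \<omega> i (j + s) (k + (2 ^ Suc p - 1 - s)))"
    by (subst add.commute, subst sum.union_disjoint[symmetric]) (auto intro!: sum.cong)
  finally show ?case .
qed simp

section \<open>Upper bounds for the growth of the kernel in degree three\<close>

text \<open>The dimension k_3 for N variables, taken as a logarithm so that estimates of
  cardinalities become additive.\<close>

definition kdim3 :: "nat \<Rightarrow> real" where
  "kdim3 N = log 2 (card (kernel_forms (Suc N) 3))"

lemma finite_kernel_forms [simp]: "finite (kernel_forms n q)"
  by (simp add: kernel_forms_def)

lemma kernel_forms_nonempty [simp]: "kernel_forms n q \<noteq> {}"
  by (auto simp: kernel_forms_def intro!: exI[of _ 0])

lemma card_kernel_forms_pos: "card (kernel_forms n q) > 0"
  by (simp add: card_gt_0_iff)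

text \<open>The coefficient of the last variable, numbered N, again lies in the kernel of D, so its
  entries (a, a + 1) determine it. If they all vanish, the last variable does not occur; in general
  at most m of them are free.\<close>

lemma kdim3_le:
  assumes z: "\<And>\<omega> a. \<omega> \<in> kernel_forms (Suc (Suc N)) 3 \<Longrightarrow> m \<le> a \<Longrightarrow> coef3 \<omega> N a (Suc a) = 0"
  shows "kdim3 (Suc N) \<le> kdim3 N + m"
proof -
  let ?K = "kernel_forms (Suc (Suc N)) 3"
  define F where "F \<omega> = (\<lambda>a. coef3 \<omega> N a (Suc a))" for \<omega>
  let ?S = "{f :: nat \<Rightarrow> bit. \<forall>a. f a \<noteq> 0 \<longrightarrow> a \<in> {..<m}}"
  have "{\<omega> \<in> ?K. F \<omega> = 0} \<subseteq> kernel_forms (Suc N) 3"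
  proof
    fix \<omega> assume "\<omega> \<in> {\<omega> \<in> ?K. F \<omega> = 0}"
    then have \<omega>: "\<omega> \<in> ?K" and F: "coef3 \<omega> N a (Suc a) = 0" for a by (auto simp: F_def fun_eq_iff)
    then have t: "\<omega> \<in> tail_forms (Suc (Suc N)) 3" by (simp add: kernel_forms_def)
    \<comment> \<open>Raising the last index leaves the range, so the three-term relation becomes
      the antidiagonal relation of degree two.\<close>
    have "coef3 \<omega> N (Suc i) j + coef3 \<omega> N i (Suc j) = 0" for i j
      using coef3_kernel[OF \<omega>, of N i j] coef3_eq_0[OF t, of "Suc N" i j] by simp
    then have step: "coef3 \<omega> N (Suc i) j = coef3 \<omega> N i (Suc j)" for i j
      by (simp add: bit_add_eq_0_iff)
    have b: "coef3 \<omega> N i j = 0" for i j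
      by (rule antidiagonal_eq_0[of "coef3 \<omega> N", OF step coef3_commute(2) _ F]) simp
    have "I \<subseteq> {2..Suc N} \<and> card I = 3" if I: "\<omega> I \<noteq> 0" for I
    proof -
      from I t have *: "I \<subseteq> {2..Suc (Suc N)}" "card I = 3" unfolding tail_forms_def by blast+
      have "Suc (Suc N) \<notin> I"
      proof
        assume N: "Suc (Suc N) \<in> I"
        have "finite I" using *(1) by (rule finite_subset) simp
        from card.remove[OF this N] *(2) have "card (I - {Suc (Suc N)}) = 2" by simp
        then obtain u v where uv: "I - {Suc (Suc N)} = {u, v}" "u \<noteq> v" by (auto simp: card_2_iff)
        then have m: "u \<in> I" "v \<in> I" "u \<noteq> Suc (Suc N)" "v \<noteq> Suc (Suc N)" by auto
        with *(1) have "2 \<le> u" "2 \<le> v" by auto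
        then obtain i j where "u = i + 2" "v = j + 2" by (metis add.commute le_Suc_ex)
        moreover have "I = {Suc (Suc N), u, v}" using uv(1) N by auto
        ultimately have "\<omega> I = coef3 \<omega> N i j"
          using uv(2) m by (auto simp: coef3_def)
        then show False using I b by simp
      qed
      then have "k \<in> {2..Suc N}" if "k \<in> I" for k
      proof -
        have "k \<noteq> Suc (Suc N)" "k \<in> {2..Suc (Suc N)}" using \<open>Suc (Suc N) \<notin> I\<close> that *(1) by auto
        then show ?thesis by simp
      qed
      then show ?thesis using *(2) by blast
    qed
    then show "\<omega> \<in> kernel_forms (Suc N) 3" using \<omega> by (simp add: kernel_forms_def tail_forms_def)
  qed
  then have k: "card {\<omega> \<in> ?K. F \<omega> = 0} \<le> card (kernel_forms (Suc N) 3)"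
    by (intro card_mono) simp_all
  have "F ` ?K \<subseteq> ?S"
  proof
    fix f assume "f \<in> F ` ?K"
    then have "f a = 0" if "m \<le> a" for a using z that by (auto simp: F_def)
    then have "a \<in> {..<m}" if "f a \<noteq> 0" for a using that by (meson lessThan_iff not_le)
    then show "f \<in> ?S" by blast
  qed
  then have "card (F ` ?K) \<le> card ?S"
    by (intro card_mono card_bit_functions) simp_all
  also have "\<dots> = 2 ^ m" by (subst card_bit_functions) simp_all
  finally have "card (F ` ?K) * card {\<omega> \<in> ?K. F \<omega> = 0} \<le> 2 ^ m * card (kernel_forms (Suc N) 3)"
    using k by (rule mult_le_mono)
  moreover have "card ?K = card (F ` ?K) * card {\<omega> \<in> ?K. F \<omega> = 0}"
    by (rule card_eq_card_image_times_card_kernel)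
      (auto simp: kernel_forms_def tail_forms_add shift_add F_def coef3_add fun_eq_iff)
  ultimately have "card ?K \<le> 2 ^ m * card (kernel_forms (Suc N) 3)" by (simp only:)
  from of_nat_mono[where ?'a = real, OF this]
  have "real (card ?K) \<le> 2 ^ m * real (card (kernel_forms (Suc N) 3))" by simp
  then have "log 2 (card ?K) \<le> log 2 (2 ^ m * real (card (kernel_forms (Suc N) 3)))"
    using card_kernel_forms_pos[of "Suc (Suc N)" 3] by (intro log_mono) auto
  also have "\<dots> = m + log 2 (card (kernel_forms (Suc N) 3))"
    using card_kernel_forms_pos[of "Suc N" 3] by (simp add: log_mult log_nat_power)
  finally show ?thesis by (simp add: kdim3_def)
qed

text \<open>The leading index is 2^p + (m - 1). Moving 2^p from it to a or a + 1 with a >= m gives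
  an index of at least 2^p + m, out of range.\<close>

lemma kdim3_step:
  assumes "m > 0"
  shows "kdim3 (2 ^ p + m) \<le> kdim3 (2 ^ p + m - 1) + m"
proof -
  obtain l where l: "m = Suc l" using assms by (cases m) auto
  have "kdim3 (Suc (2 ^ p + l)) \<le> kdim3 (2 ^ p + l) + m"
  proof (rule kdim3_le)
    fix \<omega> a assume \<omega>: "\<omega> \<in> kernel_forms (Suc (Suc (2 ^ p + l))) 3" and a: "m \<le> a"
    then have t: "\<omega> \<in> tail_forms (Suc (Suc (2 ^ p + l))) 3" by (simp add: kernel_forms_def)
    have "coef3 \<omega> (l + 2 ^ p) a (Suc a) = coef3 \<omega> l (a + 2 ^ p) (Suc a) + coef3 \<omega> l a (Suc a + 2 ^ p)"
      by (rule coef3_shift_power[OF \<omega>])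
    also have "\<dots> = 0" using a l by (simp add: coef3_eq_0[OF t])
    finally show "coef3 \<omega> (2 ^ p + l) a (Suc a) = 0" by (simp add: add.commute)
  qed
  then show ?thesis by (simp add: l)
qed

text \<open>
  The leading coefficient at \<open>(a, a + 1)\<close> is a sum over the antidiagonal, which the symmetry
  \<open>s \<mapsto> 2\<^sup>p - s\<close> cancels.
\<close>

lemma kdim3_power_le: "kdim3 (2 ^ p) \<le> kdim3 (2 ^ p - 1)"
proof -
  let ?P = "2 ^ p :: nat"
  define N where "N = ?P - 1"
  have P: "?P = Suc N" by (simp add: N_def)
  have "kdim3 (Suc N) \<le> kdim3 N + real 0"
  proof (rule kdim3_le)
    fix \<omega> a assume "\<omega> \<in> kernel_forms (Suc (Suc N)) 3"
    then have \<omega>: "\<omega> \<in> kernel_forms (Suc ?P) 3" by (simp add: P)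
    then have t: "\<omega> \<in> tail_forms (Suc ?P) 3" by (simp add: kernel_forms_def)
    let ?g = "\<lambda>s. coef3 \<omega> 0 (a + s) (a + (?P - s))"
    have "coef3 \<omega> N a (Suc a) = (\<Sum>s<?P. coef3 \<omega> 0 (a + s) (Suc a + (?P - 1 - s)))"
      using coef3_shift_pred_power[OF \<omega>, of 0 p a "Suc a"] by (simp add: N_def)
    also have "\<dots> = sum ?g {..<?P}"
      by (rule sum.cong) (auto intro!: arg_cong[where f = "coef3 \<omega> 0 _"])
    \<comment> \<open>For s = 0 the last index is a + 2^p, out of range.\<close>
    also have "\<dots> = sum ?g {0<..<?P}"
      by (rule sum.mono_neutral_right) (auto simp: coef3_eq_0[OF t])
    also have "\<dots> = 0"
    proof (rule sum_involution_eq_0[where h = "\<lambda>s. ?P - s"])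
      fix s assume s: "s \<in> {0<..<?P}"
      show "?g (?P - s) = ?g s" using s by (simp add: coef3_commute(2))
      \<comment> \<open>At a fixed point the last two indices agree.\<close>
      show "?g s = 0" if "?P - s = s" using that by simp
    qed auto
    finally show "coef3 \<omega> N a (Suc a) = 0" .
  qed
  then show ?thesis by (simp add: P)
qed

section \<open>The lower bound at powers of two\<close>

lemma funpow_shift_power: "shift 1 ^^ (2 ^ p) = shift (2 ^ p)"
proof (induction p)
  case (Suc p)
  have "shift 1 ^^ (2 ^ Suc p) = shift (2 ^ p) \<circ> shift (2 ^ p)"
    by (simp add: mult_2 funpow_add Suc del: One_nat_def)
  also have "\<dots> = shift (2 ^ Suc p)" by (simp add: fun_eq_iff shift_shift)
  finally show ?case .
qed simp

text \<open>Raising an index >= 2 by r leaves the range 2, ..., r + 1. For r = 2^p this is the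
  nilpotency of D on 2^p variables.\<close>

lemma shift_eq_0:
  assumes "\<omega> \<in> tail_forms (Suc r) q"
  shows "shift r \<omega> = 0"
proof
  fix I
  have "\<omega> (insert (i + r) (I - {i})) = 0" if "2 \<le> i" for i
  proof -
    have "\<not> insert (i + r) (I - {i}) \<subseteq> {2..Suc r}" using that by auto
    then show ?thesis using assms unfolding tail_forms_def by blast
  qed
  then show "shift r \<omega> I = 0 I" by (auto simp: shift_def intro!: sum.neutral)
qed

text \<open>A nilpotent operator of index at most \<open>N\<close> has a kernel of dimension at least \<open>1 / N\<close> of the whole.\<close>

lemma card_tail_forms_le:
  "card (tail_forms n q) \<le> card ((shift 1 ^^ s) ` tail_forms n q) * card (kernel_forms n q) ^ s"
proof (induction s)
  case (Suc s)
  let ?A = "(shift 1 ^^ s) ` tail_forms n q"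
  have sub: "?A \<subseteq> tail_forms n q"
    by (induction s) (auto simp: shift_tail_forms simp del: One_nat_def)
  have hom: "(shift 1 ^^ s) (\<alpha> + \<beta>) = (shift 1 ^^ s) \<alpha> + (shift 1 ^^ s) \<beta>" for \<alpha> \<beta>
    by (induction s) (simp_all only: funpow.simps id_apply comp_apply shift_add)
  have add: "x + y \<in> ?A" if "x \<in> ?A" "y \<in> ?A" for x y
  proof -
    from that obtain \<alpha> \<beta> where "\<alpha> \<in> tail_forms n q" "\<beta> \<in> tail_forms n q"
      "x = (shift 1 ^^ s) \<alpha>" "y = (shift 1 ^^ s) \<beta>" by blast
    then show ?thesis by (intro image_eqI[OF _ tail_forms_add[of \<alpha> n q \<beta>]]) (simp_all only: hom)
  qed
  have "card ?A = card (shift 1 ` ?A) * card {x \<in> ?A. shift 1 x = 0}"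
    by (rule card_eq_card_image_times_card_kernel) (auto simp: shift_add add simp del: One_nat_def image_iff)
  also have "shift 1 ` ?A = (shift 1 ^^ Suc s) ` tail_forms n q" by (simp add: image_image)
  also have "card {x \<in> ?A. shift 1 x = 0} \<le> card (kernel_forms n q)"
    using sub by (intro card_mono) (auto simp: kernel_forms_def)
  finally have "card ?A \<le> card ((shift 1 ^^ Suc s) ` tail_forms n q) * card (kernel_forms n q)"
    by simp
  then have "card ?A * card (kernel_forms n q) ^ s
      \<le> card ((shift 1 ^^ Suc s) ` tail_forms n q) * card (kernel_forms n q) ^ Suc s"
    by (simp add: mult.assoc[symmetric])
  with Suc show ?case by linarith
qed simp

lemma choose_3: "6 * real (N choose 3) = real N * (real N - 1) * (real N - 2)"
proof -
  have "(N choose 3) = (real N) gchoose 3" by (simp add: binomial_gbinomial)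
  also have "\<dots> = real N * (real N - 1) * (real N - 2) / 6"
    by (simp add: gbinomial_prod_rev numeral_3_eq_3 lessThan_Suc atLeast0_lessThan_Suc fact_numeral)
  finally show ?thesis by simp
qed

text \<open>Take s = 2^p in \<open>card_tail_forms_le\<close>, where the image is zero, then pass to
  logarithms and divide by 2^p.\<close>

lemma kdim3_power_ge: "(2 ^ p - 1) * (2 ^ p - 2) / 6 \<le> kdim3 (2 ^ p)"
proof -
  let ?P = "2 ^ p :: nat" and ?T = "tail_forms (Suc (2 ^ p)) 3" and ?K = "kernel_forms (Suc (2 ^ p)) 3"
  have "(shift 1 ^^ ?P) ` ?T = {0}"
    unfolding funpow_shift_power using shift_eq_0 tail_forms_zero by (auto intro!: image_eqI[of _ _ 0])
  then have "card ?T \<le> card ?K ^ ?P" using card_tail_forms_le[of "Suc ?P" 3 ?P] by simp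
  then have "(2::nat) ^ (?P choose 3) \<le> card ?K ^ ?P" by (simp add: card_tail_forms)
  from of_nat_mono[where ?'a = real, OF this]
  have "(2::real) ^ (?P choose 3) \<le> real (card ?K) ^ ?P" by simp
  then have "log 2 (2 ^ (?P choose 3)) \<le> log 2 (real (card ?K) ^ ?P)"
    by (intro log_mono) auto
  then have "real (?P choose 3) \<le> real ?P * kdim3 ?P"
    using card_kernel_forms_pos[of "Suc ?P" 3] by (simp add: kdim3_def log_nat_power)
  then have "real ?P * ((real ?P - 1) * (real ?P - 2)) \<le> real ?P * (6 * kdim3 ?P)"
    using choose_3[of ?P] by (simp add: algebra_simps)
  then have "(real ?P - 1) * (real ?P - 2) \<le> 6 * kdim3 ?P"
    by (rule mult_left_le_imp_le) simp
  then show ?thesis by simp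
qed

section \<open>Sharpness of the bounds\<close>

text \<open>Adds up the increments m + 1, ..., m + d as a difference of triangular numbers.\<close>

lemma kdim3_add_le:
  "kdim3 (2 ^ p + (m + d)) \<le> kdim3 (2 ^ p + m) + (real (m + d) * (real (m + d) + 1) - real m * (real m + 1)) / 2"
proof (induction d)
  case (Suc d)
  have "kdim3 (2 ^ p + (m + Suc d)) \<le> kdim3 (2 ^ p + (m + d)) + real (m + Suc d)"
    using kdim3_step[of "m + Suc d" p] by simp
  with Suc show ?case by (simp add: field_simps)
qed simp

text \<open>\<open>kdim3_add_le\<close> climbs from 2^p + m to 2^(p+1) - 1, and by
  \<open>kdim3_power_le\<close> the last step to 2^(p+1) costs nothing.\<close>

lemma kdim3_double_le:
  assumes "m < 2 ^ p"
  shows "kdim3 (2 ^ Suc p) \<le> kdim3 (2 ^ p + m) + (2 ^ p * (2 ^ p - 1) - real m * (real m + 1)) / 2"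
proof -
  let ?P = "2 ^ p :: nat"
  have "2 ^ Suc p - 1 = ?P + (m + (?P - 1 - m))" using assms by simp
  then have "kdim3 (2 ^ Suc p) \<le> kdim3 (?P + (m + (?P - 1 - m)))"
    using kdim3_power_le[of "Suc p"] by presburger
  also note kdim3_add_le
  also have "real (m + (?P - 1 - m)) = 2 ^ p - 1" using assms by (simp add: of_nat_diff)
  finally show ?thesis by (simp add: mult.commute)
qed

text \<open>The increment allowed by \<open>kdim3_double_le\<close> for m = 0 is exactly the
  difference of the lower bounds at 2^p and 2^(p+1), so the upper bound follows by
  induction.\<close>

lemma kdim3_power: "kdim3 (2 ^ p) = (2 ^ p - 1) * (2 ^ p - 2) / 6"
proof (rule antisym)
  show "kdim3 (2 ^ p) \<le> (2 ^ p - 1) * (2 ^ p - 2) / 6"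
  proof (induction p)
    case 0
    \<comment> \<open>A single variable carries no nonzero form of degree three.\<close>
    have "card (kernel_forms 2 3) \<le> card (tail_forms 2 3)"
      by (rule card_mono) (auto simp: kernel_forms_def)
    also have "\<dots> = 1" by (simp add: card_tail_forms)
    finally have "card (kernel_forms 2 3) = 1" using card_kernel_forms_pos[of 2 3] by linarith
    then show ?case by (simp add: kdim3_def numeral_2_eq_2)
  next
    case (Suc p)
    have "kdim3 (2 ^ Suc p) \<le> kdim3 (2 ^ p) + 2 ^ p * (2 ^ p - 1) / 2"
      using kdim3_double_le[of 0 p] by simp
    also have "\<dots> \<le> (2 ^ p - 1) * (2 ^ p - 2) / 6 + 2 ^ p * (2 ^ p - 1) / 2"
      using Suc by simp
    also have "\<dots> = (2 ^ Suc p - 1) * (2 ^ Suc p - 2) / 6" by (simp add: field_simps)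
    finally show ?case .
  qed
qed (rule kdim3_power_ge)

text \<open>The value at 2^p gives the upper bound. The lower bound comes from the value at 2^(p+1),
  which the admissible increments could not reach from anything smaller.\<close>

lemma kdim3_eq:
  assumes "m < 2 ^ p"
  shows "kdim3 (2 ^ p + m) = (2 ^ p - 1) * (2 ^ p - 2) / 6 + real m * (real m + 1) / 2"
proof (rule antisym)
  show "kdim3 (2 ^ p + m) \<le> (2 ^ p - 1) * (2 ^ p - 2) / 6 + real m * (real m + 1) / 2"
    using kdim3_add_le[of p 0 m] by (simp add: kdim3_power)
  have "(2 ^ Suc p - 1) * (2 ^ Suc p - 2) / 6
      \<le> kdim3 (2 ^ p + m) + (2 ^ p * (2 ^ p - 1) - real m * (real m + 1)) / 2"
    using kdim3_double_le[OF assms] unfolding kdim3_power .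
  then show "(2 ^ p - 1) * (2 ^ p - 2) / 6 + real m * (real m + 1) / 2 \<le> kdim3 (2 ^ p + m)"
    by (simp add: field_simps)
qed

section \<open>The first three Betti numbers\<close>

theorem corollary1:
  fixes n p m :: nat
  assumes "n \<ge> 5" and "n = 2 ^ p + m" and "0 < m" and "m \<le> 2 ^ p"
  shows "betti n (m2_bracket n) 1 = 2
    \<and> int (betti n (m2_bracket n) 2) = \<lfloor>1 / 2 * (real n + 1)\<rfloor>
    \<and> real (betti n (m2_bracket n) 3) =
        1 / 3 * (2 ^ p - 1) * (2 powi (int p - 1) - 1) + 1 / 2 * real m * (real m - 1)
          + real_of_int \<lfloor>1 / 2 * (real n - 1)\<rfloor>"
proof (intro conjI)
  let ?b = "betti n (m2_bracket n)"
  have n: "2 \<le> n" using assms(1) by simp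
  \<comment> \<open>Here k_0 = k_1 = 1.\<close>
  have "(2::nat) ^ ?b 1 = 2 ^ 2"
    using two_power_betti_m2[OF n, of 0] card_kernel_forms_1[OF n] by (simp add: card_kernel_forms_0)
  then show "?b 1 = 2" by (subst (asm) power_inject_exp) simp_all
  \<comment> \<open>Here k_2 = (n - 1) div 2 and k_1 = 1.\<close>
  have "(2::nat) ^ ?b 2 = 2 ^ ((n - 1) div 2 + 1)"
    using two_power_betti_m2[OF n, of 1] card_kernel_forms_1[OF n] card_kernel_forms_2[OF n]
    by (simp add: numeral_2_eq_2)
  then have "?b 2 = (n - 1) div 2 + 1" by (subst (asm) power_inject_exp) simp_all
  also have "\<dots> = (n + 1) div 2" using n by simp
  finally show "int (?b 2) = \<lfloor>1 / 2 * (real n + 1)\<rfloor>"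
    using floor_divide_of_nat_eq[of "n + 1" 2, where ?'a = real] by (simp add: add.commute)
  \<comment> \<open>\<open>kdim3\<close> counts N = n - 1 = 2^p + (m - 1) variables, and 0 < m <=
    2^p puts m - 1 into the range of \<open>kdim3_eq\<close>.\<close>
  define l where "l = m - 1"
  have l: "m = Suc l" "l < 2 ^ p" "n = Suc (2 ^ p + l)" using assms by (simp_all add: l_def)
  have "(2::nat) ^ ?b 3 = card (kernel_forms n 3) * 2 ^ ((n - 1) div 2)"
    using two_power_betti_m2[OF n, of 2] card_kernel_forms_2[OF n] by simp
  then have "log 2 (2 ^ ?b 3) = log 2 (card (kernel_forms n 3) * 2 ^ ((n - 1) div 2))"
    by (metis of_nat_mult of_nat_numeral of_nat_power)
  then have "real (?b 3) = kdim3 (2 ^ p + l) + real ((n - 1) div 2)"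
    using card_kernel_forms_pos[of n 3] by (simp add: log_mult log_nat_power kdim3_def l(3))
  moreover have "real_of_int \<lfloor>1 / 2 * (real n - 1)\<rfloor> = real ((n - 1) div 2)"
    using floor_divide_of_nat_eq[of "n - 1" 2, where ?'a = real] n by (simp add: of_nat_diff)
  moreover have "(2::real) powi (int p - 1) = 2 ^ p / 2" by (simp add: power_int_diff)
  ultimately show "real (?b 3) =
        1 / 3 * (2 ^ p - 1) * (2 powi (int p - 1) - 1) + 1 / 2 * real m * (real m - 1)
          + real_of_int \<lfloor>1 / 2 * (real n - 1)\<rfloor>"
    by (simp only: kdim3_eq[OF l(2)]) (simp add: l(1) field_simps)
qed

end
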